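(* Let $a_0>0$ and $\tilde a_0\ge 10$ be constants and let $\xi=\xi_N$ be a sequence of parameters with $1+a_0\le \xi_N\le \tilde a_0\log\log N$. Then there exists a constant $C>0$, not depending on $N$, such that for every $p=p(N)\in[0,1]$ with $$\frac{(\log N)^{2C\xi_N}}{Np}\to 0\quad\text{as } N\to\infty,$$ the following holds for the Erdős–Rényi random graph $G(N,p)$ on vertex set $V$, $|V|=N$: asymptotically almost surely $$H^i=N(1+o(1))\quad\text{for each } i\in V,$$ where $H^i=\sum_{j\in V}\pi_j h_{ij}$ is the random starting time of the simple random walk on the graph.
   Context: $G(N,p)$ is the random graph on $N$ vertices in which each edge is present independently with probability $p=p(N)\in[0,1]$; $\mathbb{P}_p$ is its law, and $(V,\mathcal{E})$ denotes a realization. An event $A_N$ holds asymptotically almost surely (a.a.s.) if $\mathbb{P}_p(A_N)\to1$ as $N\to\infty$. The statement "a.a.s. $H^i=N(1+o(1))$ for each $i\in V$" means that there is a deterministic sequence $\varepsilon_N\to0$ such that $\mathbb{P}_p(|H^i/N-1|\le\varepsilon_N\text{ for each } i\in V)\to1$. For a connected realization $(V,\mathcal{E})$, $d_i$ is the degree of vertex $i$, $|\mathcal{E}|$ is the number of edges, and $(X_n)_{n\in\mathbb{N}}$ is the simple random walk on $(V,\mathcal{E})$, i.e. the Markov chain on $V$ with transition probabilities $p_{ij}=1/d_i$ if $ij\in\mathcal{E}$ and $0$ otherwise. Its stationary distribution is $\pi_i=d_i/(2|\mathcal{E}|)$. The hitting time is $h_{ij}=\mathbb{E}_i(\tau_j)$,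 where $\tau_j=\inf\{m>0: X_m=j\}$ and $\mathbb{E}_i$ is the expectation for the walk started at $X_0=i$ (with the graph fixed). The quantities $h_{ij}$ and $H^i$ are random through the graph; they are considered when the graph is connected, and the a.a.s. assertion includes that the graph is connected. *)

theory Defs
  imports "HOL-Probability.Probability"
begin

section \<open>The random graph\<close>

text \<open>A simple graph on \<open>{..<N}\<close> is given by its edge set, a set of two-element subsets of \<open>{..<N}\<close>.\<close>

definition vertex_pairs :: "nat \<Rightarrow> nat set set" where
  "vertex_pairs N = {e. e \<subseteq> {..<N} \<and> card e = 2}"

definition gnp :: "nat \<Rightarrow> real \<Rightarrow> nat set set pmf" where
  "gnp N p = map_pmf (\<lambda>f. {e \<in> vertex_pairs N. f e})
     (Pi_pmf (vertex_pairs N) False (\<lambda>_. bernoulli_pmf p))"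

definition connected_graph :: "nat \<Rightarrow> nat set set \<Rightarrow> bool" where
  "connected_graph N E \<longleftrightarrow> (\<forall>i<N. \<forall>j<N. (i, j) \<in> {(u, v). {u, v} \<in> E}\<^sup>*)"

definition neighbours :: "nat set set \<Rightarrow> nat \<Rightarrow> nat set" where
  "neighbours E i = {j. {i, j} \<in> E}"

definition vertex_degree :: "nat set set \<Rightarrow> nat \<Rightarrow> nat" where
  "vertex_degree E i = card (neighbours E i)"

section \<open>The simple random walk\<close>

text \<open>At a vertex without neighbours (which a connected graph on at least two vertices does not
  have) the walk stays put; this is only a convention to make the step distribution total.\<close>

definition walk_step :: "nat set set \<Rightarrow> nat \<Rightarrow> nat pmf" where
  "walk_step E i =
     (if neighbours E i = {} then return_pmf i else pmf_of_set (neighbours E i))"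

lemma pmf_walk_step:
  assumes "finite (neighbours E i)" "neighbours E i \<noteq> {}"
  shows "pmf (walk_step E i) j = (if {i, j} \<in> E then 1 / real (vertex_degree E i) else 0)"
  using assms by (simp add: walk_step_def vertex_degree_def) (simp add: neighbours_def indicator_def)

text \<open>The law of \<open>X\<^sub>n\<close> given \<open>X\<^sub>0, \<dots>, X\<^bsub>n-1\<^esub>\<close>, for the walk started at \<open>i\<close>.\<close>

definition walk_kernel :: "nat set set \<Rightarrow> nat \<Rightarrow> nat \<Rightarrow> (nat \<Rightarrow> nat) \<Rightarrow> nat measure" where
  "walk_kernel E i n \<omega> =
     measure_pmf (case n of 0 \<Rightarrow> return_pmf i | Suc m \<Rightarrow> walk_step E (\<omega> m))"

lemma Ionescu_Tulcea_walk: "Ionescu_Tulcea (walk_kernel E i) (\<lambda>_. count_space UNIV)"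
proof (rule Ionescu_Tulcea.intro)
  show "walk_kernel E i n \<in> measurable (PiM {0..<n} (\<lambda>_. count_space UNIV))
      (subprob_algebra (count_space UNIV))" for n
  proof (cases n)
    case 0
    have "measure_pmf (return_pmf i) \<in> space (subprob_algebra (count_space UNIV))"
      by (simp add: space_subprob_algebra measure_pmf.subprob_space_axioms)
    then show ?thesis
      by (simp add: walk_kernel_def[abs_def] 0)
  next
    case (Suc m)
    have a: "(\<lambda>x. measure_pmf (walk_step E x)) \<in>
        measurable (count_space UNIV) (subprob_algebra (count_space UNIV))"
      by (auto simp: space_subprob_algebra intro!: measure_pmf.subprob_space_axioms)
    have "(\<lambda>\<omega>. \<omega> m) \<in> measurable (PiM {0..<Suc m} (\<lambda>_. count_space UNIV)) (count_space UNIV)"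
      by (rule measurable_component_singleton) simp
    from measurable_compose[OF this a] show ?thesis
      by (simp add: walk_kernel_def[abs_def] Suc)
  qed
  show "prob_space (walk_kernel E i n x)"
    if "x \<in> space (PiM {0..<n} (\<lambda>_. count_space UNIV))" for n x
    unfolding walk_kernel_def by (rule measure_pmf.prob_space_axioms)
qed

text \<open>The law of the trajectory \<open>(X\<^sub>n)\<close> of the walk started at \<open>i\<close>: the projective limit provided by
  the Ionescu-Tulcea theorem.\<close>

definition walk :: "nat set set \<Rightarrow> nat \<Rightarrow> (nat \<Rightarrow> nat) measure" where
  "walk E i = projective_family.lim UNIV
     (Ionescu_Tulcea.CI (walk_kernel E i) (\<lambda>_. count_space UNIV)) (\<lambda>_. count_space UNIV)"

lemma sets_walk: "sets (walk E i) = sets (PiM UNIV (\<lambda>_. count_space UNIV))"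
proof -
  interpret Ionescu_Tulcea "walk_kernel E i" "\<lambda>_. count_space UNIV"
    by (rule Ionescu_Tulcea_walk)
  show ?thesis unfolding walk_def by (rule PF.sets_lim)
qed

lemma prob_space_walk: "prob_space (walk E i)"
proof -
  interpret Ionescu_Tulcea "walk_kernel E i" "\<lambda>_. count_space UNIV"
    by (rule Ionescu_Tulcea_walk)
  have "emeasure PF.lim (PF.emb UNIV {} {\<lambda>_. undefined}) = emeasure (CI {}) {\<lambda>_. undefined}"
    by (rule lim) (auto simp: PiM_empty)
  also have "\<dots> = 1"
    using prob_space.emeasure_space_1[OF PF.prob_space_P[of "{}"]]
    by (simp add: PF.space_P space_PiM_empty)
  finally show ?thesis
    by (intro prob_spaceI) (simp add: walk_def space_PiM prod_emb_def restrict_def vimage_def)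
qed

text \<open>Together with \<open>prob_space_walk\<close> this characterizes the simple random walk started at \<open>i\<close>.\<close>

lemma emeasure_walk_cylinder:
  "emeasure (walk E i) {\<omega>. \<forall>k\<le>n. \<omega> k = x k} =
     ennreal ((if x 0 = i then 1 else 0) * (\<Prod>k<n. pmf (walk_step E (x k)) (x (Suc k))))"
proof -
  let ?M = "\<lambda>_::nat. count_space (UNIV :: nat set)"
  interpret Ionescu_Tulcea "walk_kernel E i" ?M
    by (rule Ionescu_Tulcea_walk)
  define r where "r m = restrict x {0..<m}" for m
  define U where "U = (\<lambda>_::nat. undefined :: nat)"
  have r_eq: "{r m} = PiE {0..<m} (\<lambda>k. {x k})" for m
  proof -
    have "PiE {0..<m} (\<lambda>k. {r m k}) = {r m}"
      by (rule PiE_singleton) (unfold r_def, rule restrict_extensional)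
    moreover have "PiE {0..<m} (\<lambda>k. {r m k}) = PiE {0..<m} (\<lambda>k. {x k})"
      by (rule PiE_cong) (simp add: r_def)
    ultimately show ?thesis by simp
  qed
  have r_sets[measurable]: "{r m} \<in> sets (PiM {0..<m} ?M)" for m
    unfolding r_eq by (rule sets_PiM_I_finite) auto
  have r_space: "r m \<in> space (PiM {0..<m} ?M)" for m
    by (simp add: r_def space_PiM)
  have U: "U \<in> space (PiM {0..<0} ?M)"
    by (simp add: U_def space_PiM)
  have step: "emeasure (C 0 (Suc m) U) {r (Suc m)} =
      emeasure (C 0 m U) {r m} * emeasure (walk_kernel E i m (r m)) {x m}" for m
  proof -
    have sp: "space (C 0 m U) = space (PiM {0..<m} ?M)"
      using space_C[OF U, of m] by simp
    have st: "sets (C 0 m U) = sets (PiM {0..<m} ?M)"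
      using sets_C[OF U, of m] by simp
    have eP: "emeasure (eP m \<omega>) {r (Suc m)} =
        emeasure (walk_kernel E i m (r m)) {x m} * indicator {r m} \<omega>"
      if w: "\<omega> \<in> space (PiM {0..<m} ?M)" for \<omega>
    proof -
      have ext: "\<omega> k = undefined" if "k \<ge> m" for k
        using w that by (auto simp: space_PiM PiE_iff extensional_def)
      have upd: "fun_upd \<omega> m y = r (Suc m) \<longleftrightarrow> \<omega> = r m \<and> y = x m" for y
        using ext by (auto simp: r_def fun_eq_iff restrict_def not_less less_Suc_eq split: if_splits)
      have "(\<lambda>y. fun_upd \<omega> m y) -` {r (Suc m)} \<inter> space (count_space UNIV) =
          (if \<omega> = r m then {x m} else {})"
        using upd by auto
      then show ?thesis
        by (simp add: emeasure_eP[OF w r_sets])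
    qed
    have "emeasure (C 0 (Suc m) U) {r (Suc m)} =
        (\<integral>\<^sup>+\<omega>. emeasure (eP m \<omega>) {r (Suc m)} \<partial>C 0 m U)"
      using measurable_eP[of m] r_space[of m] r_sets[of "Suc m"]
      by (simp, subst emeasure_bind[where N = "PiM {0..<Suc m} ?M"])
         (auto simp: sp measurable_cong_sets[OF st refl])
    also have "\<dots> = (\<integral>\<^sup>+\<omega>. emeasure (walk_kernel E i m (r m)) {x m} * indicator {r m} \<omega> \<partial>C 0 m U)"
      by (rule nn_integral_cong) (simp add: sp eP)
    also have "\<dots> = emeasure (walk_kernel E i m (r m)) {x m} * emeasure (C 0 m U) {r m}"
      by (rule nn_integral_cmult_indicator) (simp add: st)
    finally show ?thesis by (simp add: mult.commute)
  qed
  have "emeasure (C 0 (Suc m) U) {r (Suc m)} =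
      ennreal ((if x 0 = i then 1 else 0) * (\<Prod>k<m. pmf (walk_step E (x k)) (x (Suc k))))" for m
  proof (induction m)
    case 0
    have "r 0 = U" by (simp add: r_def U_def restrict_def)
    moreover have "emeasure (return (PiM {0..<0} ?M) U) {r 0} = indicator {r 0} U"
      by (rule emeasure_return) (rule r_sets)
    ultimately show ?case
      unfolding step by (simp add: walk_kernel_def indicator_def emeasure_pmf_single)
  next
    case (Suc m)
    show ?case
      unfolding step[of "Suc m"] Suc.IH
      by (simp add: walk_kernel_def emeasure_pmf_single r_def
          ennreal_mult[symmetric] prod_nonneg)
  qed
  moreover have "{\<omega>. \<forall>k\<le>n. \<omega> k = x k} = PF.emb UNIV {0..<Suc n} {r (Suc n)}"
    unfolding r_eq
    by (auto simp: prod_emb_def space_PiM PiE_iff less_Suc_eq_le)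
  moreover have "PF.emb {0..<Suc n} {0..<Suc n} {r (Suc n)} = {r (Suc n)}"
    by (rule prod_emb_id) (simp add: r_def PiE_iff)
  ultimately show ?thesis
    using lim[of "{0..<Suc n}" "{r (Suc n)}"] r_sets[of "Suc n"]
      emeasure_CI[of "{0..<Suc n}" "Suc n" "{r (Suc n)}"]
    by (simp add: walk_def U_def del: C.simps)
qed

text \<open>The infimum of the empty set is \<open>\<infinity>\<close>. The time \<open>0\<close> does not count, so that
  \<open>mean_hitting_time E i i\<close> is the mean return time.\<close>

definition hitting_time :: "nat \<Rightarrow> (nat \<Rightarrow> nat) \<Rightarrow> enat" where
  "hitting_time j \<omega> = Inf {enat m | m. m > 0 \<and> \<omega> m = j}"

definition mean_hitting_time :: "nat set set \<Rightarrow> nat \<Rightarrow> nat \<Rightarrow> ennreal" where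
  "mean_hitting_time E i j = (\<integral>\<^sup>+ \<omega>. ennreal_of_enat (hitting_time j \<omega>) \<partial>walk E i)"

definition stationary :: "nat set set \<Rightarrow> nat \<Rightarrow> real" where
  "stationary E i = real (vertex_degree E i) / (2 * real (card E))"

definition random_starting_time :: "nat \<Rightarrow> nat set set \<Rightarrow> nat \<Rightarrow> ennreal" where
  "random_starting_time N E i =
     (\<Sum>j<N. ennreal (stationary E j) * mean_hitting_time E i j)"

end

(* Write g(i,j) for the mean time to reach j from i (0 if i = j). Since (I - P) g(.,j) = 1 - 1_j / pi_j,
   the function F = sum_j pi_j g(.,j) is harmonic, hence equal to a constant kappa, and H^i = kappa + 1.
   For the centred function w_j = g(.,j) - t_j, with t_j the pi-mean of g(.,j), the same equation gives the
   Dirichlet form D(w_j) = t_j and, at the point j, pi_j t_j = 1 - pi_j - pi_j (P w_j)(j). Summing over j,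
   kappa = N - 1 - err, and Cauchy-Schwarz with a Poincare inequality of constant gamma bounds
   err^2 by kappa * tr(P^2) / gamma <= kappa * N / (gamma * min degree). So no sharp spectral
   information is needed: it is enough that gamma * (min degree) tends to infinity.

   A.a.s. every set S of at most N/2 vertices has at least (Np/8)|S| outgoing edges and all degrees are
   at most 4Np (Chernoff and a union bound, with sum_S x^|S| = (1 + x)^N). Cheeger's argument turns this
   into a Poincare inequality with gamma of constant order, and singletons S bound the minimal degree. *)

theory Submission
  imports Defs "HOL-Real_Asymp.Real_Asymp"
begin

section \<open>Mean hitting times as sums of avoidance probabilities\<close>

lemma space_walk: "space (walk E i) = UNIV"
  using sets_eq_imp_space_eq[OF sets_walk] by (simp add: space_PiM)

lemma measurable_walk_component [measurable]: "(\<lambda>\<omega>. \<omega> k) \<in> measurable (walk E i) (count_space UNIV)"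
  unfolding measurable_cong_sets[OF sets_walk refl] by (rule measurable_component_singleton) simp

text \<open>The probability that the walk from \<open>i\<close> is away from \<open>j\<close> at
  times 1 to n. Time 0 is exempt, as in \<open>hitting_time\<close>, so \<open>i = j\<close> is a
  legitimate start.\<close>

primrec avoid :: "nat set set \<Rightarrow> nat \<Rightarrow> nat \<Rightarrow> nat \<Rightarrow> ennreal" where
  "avoid E j 0 i = 1"
| "avoid E j (Suc n) i = (\<integral>\<^sup>+ k. (if k = j then 0 else avoid E j n k) \<partial>walk_step E i)"

lemma sets_walk_Collect:
  assumes "Measurable.pred (walk E i) P"
  shows "{\<omega>. P \<omega>} \<in> sets (walk E i)"
  using assms by (simp add: pred_def space_walk)

text \<open>Markov property at time \<open>m\<close>: splitting by the position at time
  \<open>m + 1\<close> lengthens the fixed prefix by one step, which is why the induction keeps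
  \<open>m\<close> and \<open>x\<close> arbitrary.\<close>

lemma emeasure_walk_avoid:
  "emeasure (walk E i) {\<omega>. (\<forall>k\<in>{..m}. \<omega> k = x k) \<and> (\<forall>k\<in>{m<..m + n}. \<omega> k \<noteq> j)} =
     emeasure (walk E i) {\<omega>. \<forall>k\<le>m. \<omega> k = x k} * avoid E j n (x m)"
proof (induction n arbitrary: m x)
  case 0
  show ?case by (simp add: atMost_def)
next
  case (Suc n)
  let ?y = "\<lambda>y. x(Suc m := y)"
  let ?B = "\<lambda>y. {\<omega>. (\<forall>k\<in>{..Suc m}. \<omega> k = ?y y k) \<and> (\<forall>k\<in>{Suc m<..Suc m + n}. \<omega> k \<noteq> j)}"
  let ?c = "emeasure (walk E i) {\<omega>. \<forall>k\<le>m. \<omega> k = x k}"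
  have split: "{m<..m + Suc n} = insert (Suc m) {Suc m<..Suc m + n}" by auto
  have atMost: "{..Suc m} = insert (Suc m) {..m}" by auto
  have "{\<omega>. (\<forall>k\<in>{..m}. \<omega> k = x k) \<and> (\<forall>k\<in>{m<..m + Suc n}. \<omega> k \<noteq> j)} = (\<Union>y\<in>-{j}. ?B y)"
    unfolding split atMost by auto
  moreover have "emeasure (walk E i) (\<Union>y\<in>-{j}. ?B y) =
      (\<integral>\<^sup>+ y. emeasure (walk E i) (?B y) \<partial>count_space (-{j}))"
  proof (rule emeasure_UN_countable)
    show "?B y \<in> sets (walk E i)" for y
      by (rule sets_walk_Collect) measurable
    show "disjoint_family_on ?B (- {j})"
      by (auto simp: disjoint_family_on_def)
  qed auto
  moreover have "emeasure (walk E i) (?B y) = ?c * (ennreal (pmf (walk_step E (x m)) y) * avoid E j n y)" for y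
    unfolding Suc.IH[of "Suc m" "?y y"] emeasure_walk_cylinder
    by (simp add: ennreal_mult' prod_nonneg mult.assoc lessThan_Suc mult.commute[of "pmf _ _"])
  moreover have "(\<integral>\<^sup>+ y. ?c * (ennreal (pmf (walk_step E (x m)) y) * avoid E j n y) \<partial>count_space (-{j})) =
      ?c * avoid E j (Suc n) (x m)"
  proof -
    have "(\<integral>\<^sup>+ y. ennreal (pmf (walk_step E (x m)) y) * avoid E j n y \<partial>count_space (-{j})) =
        (\<integral>\<^sup>+ y. ennreal (pmf (walk_step E (x m)) y) * (if y = j then 0 else avoid E j n y) \<partial>count_space UNIV)"
      by (subst nn_integral_count_space_indicator) (auto intro!: nn_integral_cong simp: indicator_def)
    then show ?thesis
      by (simp add: nn_integral_cmult nn_integral_measure_pmf)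
  qed
  ultimately show ?case by simp
qed

lemma hitting_time_gt: "enat n < hitting_time j \<omega> \<longleftrightarrow> (\<forall>k\<in>{0<..n}. \<omega> k \<noteq> j)"
proof
  assume a: "enat n < hitting_time j \<omega>"
  show "\<forall>k\<in>{0<..n}. \<omega> k \<noteq> j"
  proof (safe)
    fix k assume k: "k \<in> {0<..n}" "j = \<omega> k"
    then have "hitting_time j \<omega> \<le> enat k"
      unfolding hitting_time_def by (intro Inf_lower) auto
    with a k show False by (metis enat_ord_simps(1) greaterThanAtMost_iff leD order.trans)
  qed
next
  assume a: "\<forall>k\<in>{0<..n}. \<omega> k \<noteq> j"
  have "enat (Suc n) \<le> hitting_time j \<omega>"
    unfolding hitting_time_def using a by (intro Inf_greatest) (force simp: not_less_eq_eq)
  then show "enat n < hitting_time j \<omega>"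
    by (meson enat_ord_simps(2) lessI less_le_trans)
qed

text \<open>Tail-sum formula for an \<open>enat\<close>-valued variable. The tail events become
  avoidance events once the almost sure start at \<open>i\<close> is added as a prefix.\<close>

lemma mean_hitting_time_eq_suminf: "mean_hitting_time E i j = (\<Sum>n. avoid E j n i)"
proof -
  have "emeasure (walk E i) {\<omega> \<in> space (walk E i). enat n < hitting_time j \<omega>} = avoid E j n i" for n
  proof -
    have c: "emeasure (walk E i) {\<omega>. \<omega> 0 = i} = 1"
      using emeasure_walk_cylinder[of E i 0 "\<lambda>_. i"] by simp
    interpret prob_space "walk E i" by (rule prob_space_walk)
    have "{\<omega>. \<omega> 0 = i} \<in> sets (walk E i)"
      by (rule sets_walk_Collect) measurable
    then have ae: "AE \<omega> in walk E i. \<omega> 0 = i"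
      using c AE_in_set_eq_1[of "{\<omega>. \<omega> 0 = i}"] by (simp add: emeasure_eq_measure)
    have "emeasure (walk E i) {\<omega> \<in> space (walk E i). enat n < hitting_time j \<omega>} =
        emeasure (walk E i) {\<omega>. (\<forall>k\<in>{..0}. \<omega> k = i) \<and> (\<forall>k\<in>{0<..0 + n}. \<omega> k \<noteq> j)}"
      unfolding space_walk hitting_time_gt
      using ae by (intro emeasure_eq_AE sets_walk_Collect) (auto elim!: eventually_mono)
    also have "\<dots> = avoid E j n i"
      unfolding emeasure_walk_avoid[where x = "\<lambda>_. i"] using c by simp
    finally show ?thesis .
  qed
  \<comment> \<open>Measurability: a value in \<open>enat\<close> is determined by the naturals
    below it, so each level set is a countable combination of tail events.\<close>
  moreover have "hitting_time j -` {t} \<inter> space (walk E i) \<in> sets (walk E i)" for t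
  proof -
    have "hitting_time j \<omega> = t \<longleftrightarrow> (\<forall>n. enat n < hitting_time j \<omega> \<longleftrightarrow> enat n < t)" for \<omega>
    proof
      assume a: "\<forall>n. enat n < hitting_time j \<omega> \<longleftrightarrow> enat n < t"
      show "hitting_time j \<omega> = t"
      proof (rule antisym)
        show "hitting_time j \<omega> \<le> t"
          using a by (cases t) (auto simp flip: not_less)
        show "t \<le> hitting_time j \<omega>"
          using a by (cases "hitting_time j \<omega>") (auto simp flip: not_less)
      qed
    qed simp
    then have "hitting_time j -` {t} \<inter> space (walk E i) =
        {\<omega>. \<forall>n. (\<forall>k\<in>{0<..n}. \<omega> k \<noteq> j) \<longleftrightarrow> enat n < t}"
      by (auto simp: space_walk hitting_time_gt)
    also have "\<dots> \<in> sets (walk E i)"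
      by (rule sets_walk_Collect) measurable
    finally show ?thesis .
  qed
  then have "hitting_time j \<in> measurable (walk E i) (count_space UNIV)"
    by (simp add: measurable_count_space_eq2_countable)
  ultimately show ?thesis
    unfolding mean_hitting_time_def by (subst nn_integral_enat_function) auto
qed

section \<open>Cheeger and Poincare inequalities\<close>

text \<open>A weighted graph with adjacency matrix \<open>a\<close>. Expansion is relative to the
  number of vertices, as a union bound over vertex sets delivers it; \<Delta> converts degree
  weights into counting.\<close>

locale expander =
  fixes V :: "'a set" and a :: "'a \<Rightarrow> 'a \<Rightarrow> real" and \<beta> \<Delta> :: real
  assumes finite_V: "finite V" and card_V: "2 \<le> card V"
    and sym: "a i j = a j i" and nonneg: "0 \<le> a i j" and le_1: "a i j \<le> 1"
    and \<beta>_pos: "0 < \<beta>"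
    and expansion: "S \<subseteq> V \<Longrightarrow> 2 * card S \<le> card V \<Longrightarrow> \<beta> * card S \<le> (\<Sum>i\<in>S. \<Sum>j\<in>V - S. a i j)"
    and degree_le: "i \<in> V \<Longrightarrow> (\<Sum>j\<in>V. a i j) \<le> \<Delta>"
begin

section \<open>Degrees and the Dirichlet form\<close>

definition deg :: "'a \<Rightarrow> real" where
  "deg i = (\<Sum>j\<in>V. a i j)"

text \<open>The Dirichlet form without the normalisation by \<open>vol\<close>; halving counts each
  unordered pair once.\<close>

definition energy :: "('a \<Rightarrow> real) \<Rightarrow> real" where
  "energy f = (\<Sum>i\<in>V. \<Sum>j\<in>V. a i j * (f i - f j)\<^sup>2) / 2"

lemma deg_ge: "\<beta> \<le> deg i" if "i \<in> V"
proof -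
  have "\<beta> \<le> (\<Sum>j\<in>V - {i}. a i j)"
    using expansion[of "{i}"] that card_V by simp
  also have "\<dots> \<le> deg i"
    unfolding deg_def by (rule sum_mono2) (auto simp: finite_V nonneg)
  finally show ?thesis .
qed

lemma deg_pos: "i \<in> V \<Longrightarrow> 0 < deg i"
  using deg_ge \<beta>_pos by force

lemma deg_nonneg: "i \<in> V \<Longrightarrow> 0 \<le> deg i"
  using deg_pos by force

lemma deg_le: "i \<in> V \<Longrightarrow> deg i \<le> \<Delta>"
  unfolding deg_def by (rule degree_le)

lemma \<Delta>_pos: "0 < \<Delta>"
proof -
  obtain i where "i \<in> V" using card_V by fastforce
  then show ?thesis using deg_pos[of i] deg_le[of i] by simp
qed

lemma sum_swap: "(\<Sum>i\<in>V. \<Sum>j\<in>V. a i j * f j) = (\<Sum>i\<in>V. deg i * f i)"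
  by (subst sum.swap) (simp add: deg_def sum_distrib_right sym)

lemma sum_fst: "(\<Sum>i\<in>V. \<Sum>j\<in>V. a i j * f i) = (\<Sum>i\<in>V. deg i * f i)"
  by (simp add: deg_def sum_distrib_right)

lemma energy_nonneg: "0 \<le> energy f"
  by (simp add: energy_def sum_nonneg nonneg)

text \<open>Discrete Green identity, from the symmetry of \<open>a\<close>; the inner sum is the
  Laplacian of \<open>f\<close> at \<open>i\<close>, not divided by the degree.\<close>

lemma energy_eq: "energy f = (\<Sum>i\<in>V. f i * (\<Sum>j\<in>V. a i j * (f i - f j)))"
proof -
  have "2 * energy f = (\<Sum>i\<in>V. \<Sum>j\<in>V. a i j * (f i)\<^sup>2 + a i j * (f j)\<^sup>2 - 2 * (a i j * f i * f j))"
    by (simp add: energy_def power2_diff algebra_simps)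
  also have "\<dots> = (\<Sum>i\<in>V. \<Sum>j\<in>V. a i j * (f i)\<^sup>2) + (\<Sum>i\<in>V. \<Sum>j\<in>V. a i j * (f j)\<^sup>2)
      - 2 * (\<Sum>i\<in>V. \<Sum>j\<in>V. a i j * f i * f j)"
    by (simp only: sum.distrib sum_subtractf sum_distrib_left)
  also have "\<dots> = 2 * (\<Sum>i\<in>V. f i * (\<Sum>j\<in>V. a i j * (f i - f j)))"
    unfolding sum_swap sum_fst
    by (simp add: deg_def power2_eq_square algebra_simps sum.distrib sum_subtractf sum_distrib_left)
  finally show ?thesis by simp
qed

section \<open>Cheeger's inequality for functions of small support\<close>

lemma sum_cut:
  assumes "S \<subseteq> V"
  shows "(\<Sum>i\<in>V. \<Sum>j\<in>V. a i j * of_bool ((i \<in> S) \<noteq> (j \<in> S))) = 2 * (\<Sum>i\<in>S. \<Sum>j\<in>V - S. a i j)"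
proof -
  have 1: "(\<Sum>i\<in>V. \<Sum>j\<in>V. a i j * of_bool (i \<in> S \<and> j \<notin> S)) = (\<Sum>i\<in>S. \<Sum>j\<in>V - S. a i j)"
  proof -
    have "(\<Sum>j\<in>V. a i j * of_bool (i \<in> S \<and> j \<notin> S)) = (if i \<in> S then \<Sum>j\<in>V - S. a i j else 0)" for i
      by (auto simp: finite_V of_bool_def if_distrib sum.If_cases Diff_eq Collect_neg_eq cong: if_cong)
    then show ?thesis
      using assms by (simp add: sum.If_cases finite_V Int_absorb1)
  qed
  have "(\<Sum>i\<in>V. \<Sum>j\<in>V. a i j * of_bool ((i \<in> S) \<noteq> (j \<in> S))) =
      (\<Sum>i\<in>V. \<Sum>j\<in>V. a i j * of_bool (i \<in> S \<and> j \<notin> S)) +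
      (\<Sum>i\<in>V. \<Sum>j\<in>V. a i j * of_bool (j \<in> S \<and> i \<notin> S))"
    unfolding sum.distrib[symmetric] by (intro sum.cong) auto
  also have "(\<Sum>i\<in>V. \<Sum>j\<in>V. a i j * of_bool (j \<in> S \<and> i \<notin> S)) =
      (\<Sum>i\<in>V. \<Sum>j\<in>V. a i j * of_bool (i \<in> S \<and> j \<notin> S))"
    by (subst sum.swap) (simp add: sym)
  finally show ?thesis using 1 by simp
qed

text \<open>Finite coarea argument: write \<open>f\<close> as \<open>g\<close> plus \<open>m\<close>
  times the indicator of its support \<open>S\<close>, with \<open>m\<close> the least positive
  value. Expansion bounds the cut of \<open>S\<close> from below, and \<open>g\<close> has strictly
  smaller support. The factor 2 arises because the double sum sees every cut in both orders.\<close>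

lemma layer_cake:
  assumes "\<And>i. i \<in> V \<Longrightarrow> 0 \<le> f i" and "2 * card {i\<in>V. 0 < f i} \<le> card V"
  shows "2 * \<beta> * (\<Sum>i\<in>V. f i) \<le> (\<Sum>i\<in>V. \<Sum>j\<in>V. a i j * \<bar>f i - f j\<bar>)"
  using assms
proof (induction "card {i\<in>V. 0 < f i}" arbitrary: f rule: less_induct)
  case less
  define S where "S = {i\<in>V. 0 < f i}"
  have S: "S \<subseteq> V" "finite S" using finite_V by (auto simp: S_def)
  show ?case
  proof (cases "S = {}")
    case True
    then have "f i = 0" if "i \<in> V" for i
      using less.prems(1)[OF that] that by (force simp: S_def)
    then show ?thesis by simp
  next
    case False
    define m where "m = Min (f ` S)"
    define g where "g i = f i - m * of_bool (i \<in> S)" for i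
    have m: "m \<le> f i" if "i \<in> S" for i
      using that S by (simp add: m_def)
    have "m \<in> f ` S"
      unfolding m_def using S False by (intro Min_in) auto
    then obtain i0 where i0: "i0 \<in> S" "f i0 = m" by auto
    have m_pos: "0 < m" using i0 by (auto simp: S_def)
    have g_nonneg: "0 \<le> g i" if "i \<in> V" for i
      using m[of i] less.prems(1)[OF that] by (simp add: g_def)
    have zero: "f i = 0" if "i \<in> V" "i \<notin> S" for i
      using less.prems(1)[OF that(1)] that by (force simp: S_def)
    have "i \<in> S" if "i \<in> V" "0 < g i" for i
      using that zero[of i] by (cases "i \<in> S") (auto simp: g_def)
    then have "{i\<in>V. 0 < g i} \<subseteq> S" by auto
    moreover have "i0 \<notin> {i\<in>V. 0 < g i}" using i0 by (simp add: g_def)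
    ultimately have "{i\<in>V. 0 < g i} \<subset> S" using i0 by auto
    then have lt: "card {i\<in>V. 0 < g i} < card S" using S by (simp add: psubset_card_mono)
    have IH: "2 * \<beta> * (\<Sum>i\<in>V. g i) \<le> (\<Sum>i\<in>V. \<Sum>j\<in>V. a i j * \<bar>g i - g j\<bar>)"
      using less.hyps[of g] lt g_nonneg less.prems(2) by (simp add: S_def)
    have "(\<Sum>i\<in>V. f i) = (\<Sum>i\<in>V. g i) + m * card S"
    proof -
      have "S \<inter> V = S" "V \<inter> S = S" using S by auto
      then show ?thesis
        by (simp add: g_def sum_subtractf sum_distrib_left[symmetric] finite_V)
    qed
    \<comment> \<open>No cancellation occurs: \<open>f\<close> is at least \<open>m\<close> on
      \<open>S\<close> and vanishes off \<open>S\<close>, so a jump across the boundary of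
      \<open>S\<close> is the jump of \<open>g\<close> plus \<open>m\<close>.\<close>
    moreover have "(\<Sum>i\<in>V. \<Sum>j\<in>V. a i j * \<bar>f i - f j\<bar>) =
        (\<Sum>i\<in>V. \<Sum>j\<in>V. a i j * \<bar>g i - g j\<bar>) + m * (\<Sum>i\<in>V. \<Sum>j\<in>V. a i j * of_bool ((i \<in> S) \<noteq> (j \<in> S)))"
      unfolding sum_distrib_left sum.distrib[symmetric]
    proof (intro sum.cong refl)
      fix i j assume ij: "i \<in> V" "j \<in> V"
      have "\<bar>f i - f j\<bar> = \<bar>g i - g j\<bar> + m * of_bool ((i \<in> S) \<noteq> (j \<in> S))"
        using ij m[of i] m[of j] m_pos zero[of i] zero[of j] by (auto simp: g_def)
      then show "a i j * \<bar>f i - f j\<bar> = a i j * \<bar>g i - g j\<bar> + m * (a i j * of_bool ((i \<in> S) \<noteq> (j \<in> S)))"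
        by (simp add: algebra_simps)
    qed
    moreover have "m * (\<beta> * card S) \<le> m * (\<Sum>i\<in>S. \<Sum>j\<in>V - S. a i j)"
      using expansion[of S] S less.prems(2) m_pos by (intro mult_left_mono) (auto simp: S_def)
    ultimately show ?thesis
      using IH unfolding sum_cut[OF S(1)] by (simp add: algebra_simps)
  qed
qed

text \<open>\<open>layer_cake\<close> is applied to the square of \<open>f\<close>, whose
  differences factor. Cauchy-Schwarz separates the factors: one gives the energy, the other at most
  \<open>4 * \<Delta>\<close> times the sum of squares, and one power of that sum cancels.\<close>

lemma cheeger:
  assumes nn: "\<And>i. i \<in> V \<Longrightarrow> 0 \<le> f i" and supp: "2 * card {i\<in>V. 0 < f i} \<le> card V"
  shows "\<beta>\<^sup>2 * (\<Sum>i\<in>V. (f i)\<^sup>2) \<le> 2 * \<Delta> * energy f"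
proof -
  let ?X = "\<Sum>i\<in>V. (f i)\<^sup>2"
  let ?r = "\<lambda>(i, j). sqrt (a i j) * \<bar>f i - f j\<bar>" and ?s = "\<lambda>(i, j). sqrt (a i j) * (f i + f j)"
  have "{i\<in>V. 0 < (f i)\<^sup>2} = {i\<in>V. 0 < f i}" using nn by force
  then have "2 * \<beta> * ?X \<le> (\<Sum>i\<in>V. \<Sum>j\<in>V. a i j * \<bar>(f i)\<^sup>2 - (f j)\<^sup>2\<bar>)"
    using layer_cake[of "\<lambda>i. (f i)\<^sup>2"] supp by simp
  also have "\<dots> = (\<Sum>p\<in>V \<times> V. ?r p * ?s p)"
    unfolding sum.cartesian_product
  proof (intro sum.cong refl, clarify)
    fix i j assume "i \<in> V" "j \<in> V"
    then have "\<bar>(f i)\<^sup>2 - (f j)\<^sup>2\<bar> = \<bar>f i - f j\<bar> * (f i + f j)"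
      using nn[of i] nn[of j] by (simp add: power2_eq_square square_diff_square_factored abs_mult)
    then show "a i j * \<bar>(f i)\<^sup>2 - (f j)\<^sup>2\<bar> = sqrt (a i j) * \<bar>f i - f j\<bar> * (sqrt (a i j) * (f i + f j))"
      using nonneg[of i j] by simp
  qed
  finally have "(2 * \<beta> * ?X)\<^sup>2 \<le> (\<Sum>p\<in>V \<times> V. ?r p * ?s p)\<^sup>2"
    using \<beta>_pos by (intro power_mono) (auto intro!: mult_nonneg_nonneg sum_nonneg)
  also have "\<dots> \<le> (\<Sum>p\<in>V \<times> V. (?r p)\<^sup>2) * (\<Sum>p\<in>V \<times> V. (?s p)\<^sup>2)"
    by (rule Cauchy_Schwarz_ineq_sum)
  also have "(\<Sum>p\<in>V \<times> V. (?r p)\<^sup>2) = 2 * energy f"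
    unfolding energy_def sum.cartesian_product
    by (simp add: case_prod_beta power_mult_distrib nonneg)
  also have "(\<Sum>p\<in>V \<times> V. (?s p)\<^sup>2) \<le> 4 * \<Delta> * ?X"
  proof -
    have "(\<Sum>p\<in>V \<times> V. (?s p)\<^sup>2) = (\<Sum>i\<in>V. \<Sum>j\<in>V. a i j * (f i + f j)\<^sup>2)"
      unfolding sum.cartesian_product
      by (simp add: case_prod_beta power_mult_distrib nonneg)
    also have "\<dots> \<le> (\<Sum>i\<in>V. \<Sum>j\<in>V. a i j * (2 * (f i)\<^sup>2) + a i j * (2 * (f j)\<^sup>2))"
    proof (intro sum_mono)
      fix i j
      have "(f i + f j)\<^sup>2 \<le> 2 * (f i)\<^sup>2 + 2 * (f j)\<^sup>2"
        using sum_squares_ge_zero[of "f i - f j" 0] by (simp add: power2_eq_square algebra_simps)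
      from mult_left_mono[OF this nonneg[of i j]]
      show "a i j * (f i + f j)\<^sup>2 \<le> a i j * (2 * (f i)\<^sup>2) + a i j * (2 * (f j)\<^sup>2)"
        by (simp add: algebra_simps)
    qed
    also have "\<dots> = 4 * (\<Sum>i\<in>V. deg i * (f i)\<^sup>2)"
      unfolding sum.distrib sum_fst sum_swap by (simp add: sum_distrib_left mult_ac)
    also have "\<dots> \<le> 4 * (\<Sum>i\<in>V. \<Delta> * (f i)\<^sup>2)"
      by (intro mult_left_mono sum_mono mult_right_mono deg_le) auto
    finally show ?thesis by (simp add: sum_distrib_left mult_ac)
  qed
  finally have "(2 * \<beta> * ?X)\<^sup>2 \<le> 2 * energy f * (4 * \<Delta> * ?X)"
    using energy_nonneg[of f] by (simp add: mult_left_mono)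
  then have le: "(\<beta>\<^sup>2 * ?X) * ?X \<le> (2 * \<Delta> * energy f) * ?X"
    by (simp add: power2_eq_square algebra_simps)
  have "0 \<le> ?X" by (simp add: sum_nonneg)
  show ?thesis
  proof (cases "?X = 0")
    case True
    then show ?thesis using energy_nonneg[of f] \<Delta>_pos by simp
  next
    case False
    with \<open>0 \<le> ?X\<close> have "0 < ?X" by linarith
    with le show ?thesis by (rule mult_right_le_imp_le)
  qed
qed

section \<open>Medians and the Poincare inequality\<close>

lemma median:
  fixes w :: "'a \<Rightarrow> real"
  obtains c where "2 * card {i\<in>V. c < w i} \<le> card V" and "2 * card {i\<in>V. w i < c} \<le> card V"
proof -
  define Q where "Q = {x \<in> w ` V. 2 * card {i\<in>V. x < w i} \<le> card V}"
  have "V \<noteq> {}" using card_V by auto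
  have "finite Q" using finite_V by (simp add: Q_def)
  have "{i\<in>V. Max (w ` V) < w i} = {}"
    using finite_V by (auto simp: not_less)
  then have "2 * card {i\<in>V. Max (w ` V) < w i} \<le> card V" by (metis card.empty mult_0_right zero_le)
  then have "Max (w ` V) \<in> Q"
    using \<open>V \<noteq> {}\<close> finite_V by (simp add: Q_def)
  then have "Q \<noteq> {}" by auto
  define c where "c = Min Q"
  have c: "c \<in> Q" unfolding c_def using \<open>finite Q\<close> \<open>Q \<noteq> {}\<close> by (rule Min_in)
  have "2 * card {i\<in>V. w i < c} \<le> card V"
  proof (cases "{i\<in>V. w i < c} = {}")
    case False
    \<comment> \<open>The largest value below \<open>c\<close> violates the condition defining
      \<open>Q\<close>, by minimality of \<open>c\<close>. So more than half of the vertices exceed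
      \<open>y\<close>, and these are disjoint from the vertices below \<open>c\<close>.\<close>
    define y where "y = Max (w ` {i\<in>V. w i < c})"
    have "y \<in> w ` {i\<in>V. w i < c}"
      unfolding y_def using finite_V False by (intro Max_in) auto
    then have y: "y \<in> w ` V" "y < c" by auto
    have "y \<notin> Q" using y(2) Min_le[OF \<open>finite Q\<close>, of y] unfolding c_def by (meson leD)
    then have "card V < 2 * card {i\<in>V. y < w i}" using y by (simp add: Q_def)
    moreover have "w i \<le> y" if "i \<in> V" "w i < c" for i
      using that finite_V by (simp add: y_def)
    then have "{i\<in>V. y < w i} \<inter> {i\<in>V. w i < c} = {}" by force
    then have "card {i\<in>V. y < w i} + card {i\<in>V. w i < c} \<le> card V"
      using finite_V by (subst card_Un_disjoint[symmetric]) (auto intro!: card_mono)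
    ultimately show ?thesis by linarith
  qed (metis card.empty mult_0_right zero_le)
  with c that show thesis by (auto simp: Q_def)
qed

text \<open>Centring at a median leaves positive and negative parts that each live on at most half
  of the vertices, where \<open>cheeger\<close> applies. One factor \<Delta> comes from there, the
  other from replacing degree weights by counting.\<close>

lemma poincare:
  assumes mean: "(\<Sum>i\<in>V. deg i * w i) = 0"
  shows "\<beta>\<^sup>2 * (\<Sum>i\<in>V. deg i * (w i)\<^sup>2) \<le> 2 * \<Delta>\<^sup>2 * energy w"
proof -
  obtain c where c: "2 * card {i\<in>V. c < w i} \<le> card V" "2 * card {i\<in>V. w i < c} \<le> card V"
    by (rule median)
  define u where "u i = max (w i - c) 0" for i
  define v where "v i = max (c - w i) 0" for i
  have uv: "{i\<in>V. 0 < u i} = {i\<in>V. c < w i}" "{i\<in>V. 0 < v i} = {i\<in>V. w i < c}"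
      "0 \<le> u i" "0 \<le> v i" for i
    by (auto simp: u_def v_def)
  have "\<beta>\<^sup>2 * (\<Sum>i\<in>V. (u i)\<^sup>2) \<le> 2 * \<Delta> * energy u" "\<beta>\<^sup>2 * (\<Sum>i\<in>V. (v i)\<^sup>2) \<le> 2 * \<Delta> * energy v"
    using c cheeger[of u] cheeger[of v] by (simp_all add: uv)
  moreover have "(\<Sum>i\<in>V. (w i - c)\<^sup>2) = (\<Sum>i\<in>V. (u i)\<^sup>2) + (\<Sum>i\<in>V. (v i)\<^sup>2)"
    unfolding sum.distrib[symmetric]
    by (intro sum.cong refl) (auto simp: u_def v_def max_def power2_commute)
  moreover have "2 * \<Delta> * (energy u + energy v) \<le> 2 * \<Delta> * energy w"
  proof -
    \<comment> \<open>At each vertex \<open>u\<close> or \<open>v\<close> vanishes, so the product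
      of their increments is nonpositive and the two energies add up to at most that of
      \<open>w\<close>.\<close>
    have "(u i - u j)\<^sup>2 + (v i - v j)\<^sup>2 \<le> (w i - w j)\<^sup>2" for i j
    proof -
      have "w i - w j = (u i - u j) - (v i - v j)" "(u i - u j) * (v i - v j) \<le> 0"
        by (auto simp: u_def v_def max_def mult_le_0_iff)
      moreover have "(w i - w j)\<^sup>2 = (u i - u j)\<^sup>2 + (v i - v j)\<^sup>2 - 2 * ((u i - u j) * (v i - v j))"
        unfolding \<open>w i - w j = _\<close> by (simp add: power2_eq_square algebra_simps)
      ultimately show ?thesis by linarith
    qed
    then have "a i j * (u i - u j)\<^sup>2 + a i j * (v i - v j)\<^sup>2 \<le> a i j * (w i - w j)\<^sup>2" for i j
      using nonneg[of i j] by (metis distrib_left mult_left_mono)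
    then have "energy u + energy v \<le> energy w"
      unfolding energy_def add_divide_distrib[symmetric] sum.distrib[symmetric]
      by (intro divide_right_mono sum_mono) auto
    then show ?thesis using \<Delta>_pos by simp
  qed
  ultimately have 1: "\<beta>\<^sup>2 * (\<Sum>i\<in>V. (w i - c)\<^sup>2) \<le> 2 * \<Delta> * energy w"
    by (simp add: algebra_simps)
  \<comment> \<open>The mean is zero, so the cross term vanishes and moving the centre to the median
    can only increase the second moment.\<close>
  have "(\<Sum>i\<in>V. deg i * (w i - c)\<^sup>2) =
      (\<Sum>i\<in>V. deg i * (w i)\<^sup>2) - 2 * c * (\<Sum>i\<in>V. deg i * w i) + (\<Sum>i\<in>V. deg i * c\<^sup>2)"
    by (simp add: power2_diff algebra_simps sum.distrib sum_subtractf sum_distrib_left)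
  moreover have "0 \<le> (\<Sum>i\<in>V. deg i * c\<^sup>2)"
    by (intro sum_nonneg mult_nonneg_nonneg) (auto intro: less_imp_le deg_pos)
  ultimately have "(\<Sum>i\<in>V. deg i * (w i)\<^sup>2) \<le> (\<Sum>i\<in>V. deg i * (w i - c)\<^sup>2)"
    using mean by simp
  also have "\<dots> \<le> (\<Sum>i\<in>V. \<Delta> * (w i - c)\<^sup>2)"
    by (intro sum_mono mult_right_mono deg_le) auto
  finally have "(\<Sum>i\<in>V. deg i * (w i)\<^sup>2) \<le> \<Delta> * (\<Sum>i\<in>V. (w i - c)\<^sup>2)"
    by (simp add: sum_distrib_left)
  from mult_left_mono[OF this, of "\<beta>\<^sup>2"]
  have "\<beta>\<^sup>2 * (\<Sum>i\<in>V. deg i * (w i)\<^sup>2) \<le> \<Delta> * (\<beta>\<^sup>2 * (\<Sum>i\<in>V. (w i - c)\<^sup>2))"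
    by (simp add: mult_ac)
  also have "\<dots> \<le> \<Delta> * (2 * \<Delta> * energy w)"
    using 1 \<Delta>_pos by (intro mult_left_mono) auto
  finally show ?thesis by (simp add: power2_eq_square mult_ac)
qed

section \<open>Volume and functions of zero energy\<close>

definition vol :: real where
  "vol = (\<Sum>i\<in>V. deg i)"

lemma vol_pos: "0 < vol"
  unfolding vol_def using card_V by (intro sum_pos finite_V deg_pos) auto

lemma sum_deg_const: "(\<Sum>i\<in>V. deg i * c) = vol * c"
  by (simp add: vol_def sum_distrib_right)

lemma energy_shift: "energy (\<lambda>i. f i - c) = energy f"
  by (simp add: energy_def)

text \<open>The Poincare inequality for \<open>f\<close> minus its mean forces zero variance, and
  every vertex has positive weight. This is the form in which connectedness is used.\<close>

lemma energy_0_imp_constant: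
  assumes "energy f = 0" "i \<in> V"
  shows "f i = (\<Sum>i\<in>V. deg i * f i) / vol"
proof -
  let ?c = "(\<Sum>i\<in>V. deg i * f i) / vol"
  have "(\<Sum>i\<in>V. deg i * (f i - ?c)) = 0"
    unfolding right_diff_distrib sum_subtractf sum_deg_const using vol_pos by simp
  then have "\<beta>\<^sup>2 * (\<Sum>i\<in>V. deg i * (f i - ?c)\<^sup>2) \<le> 0"
    using poincare[of "\<lambda>i. f i - ?c"] assms(1) by (simp add: energy_shift)
  then have "(\<Sum>i\<in>V. deg i * (f i - ?c)\<^sup>2) \<le> 0"
    using \<beta>_pos by (simp add: mult_le_0_iff)
  moreover have "deg i * (f i - ?c)\<^sup>2 \<le> (\<Sum>i\<in>V. deg i * (f i - ?c)\<^sup>2)"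
    using assms(2) finite_V by (intro member_le_sum) (auto intro!: mult_nonneg_nonneg deg_nonneg)
  ultimately have "deg i * (f i - ?c)\<^sup>2 \<le> 0" by linarith
  then show ?thesis using deg_pos[OF assms(2)] by (simp add: mult_le_0_iff)
qed

section \<open>The random target identity\<close>

text \<open>Up to sign and the factor \<open>vol\<close>, the gap between \<open>H\<close> and the
  number of vertices is \<open>Err\<close>, which Cauchy-Schwarz bounds by a trace times a sum of
  Poincare bounds. That sum is controlled by \<open>H\<close> itself, hence a quadratic inequality
  in \<open>H\<close>.\<close>

lemma random_target:
  fixes h :: "'a \<Rightarrow> 'a \<Rightarrow> real"
  assumes rec: "\<And>i j. i \<in> V \<Longrightarrow> j \<in> V \<Longrightarrow>
      h i j = 1 + (\<Sum>k\<in>V. a i k * (if k = j then 0 else h k j)) / deg i"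
    and "i \<in> V"
  defines "\<delta> \<equiv> 2 * \<Delta>\<^sup>2 / \<beta> ^ 3" and "H \<equiv> \<Sum>j\<in>V. deg j / vol * h i j"
  shows "(H - card V)\<^sup>2 \<le> \<delta> * card V * H"
proof -
  let ?N = "real (card V)"
  define g where "g i j = (if i = j then 0 else h i j)" for i j
  have E1: "deg i * h i j = deg i + (\<Sum>k\<in>V. a i k * g k j)" if "i \<in> V" "j \<in> V" for i j
    using rec[OF that] deg_pos[OF that(1)] by (simp add: g_def field_simps)
  \<comment> \<open>Kac's formula: degree weights are stationary, so in the weighted sum of the
    first-step equations only the diagonal term survives.\<close>
  have return: "deg j * h j j = vol" if j: "j \<in> V" for j
  proof -
    have "(\<Sum>i\<in>V. deg i * h i j) = (\<Sum>i\<in>V. deg i + (\<Sum>k\<in>V. a i k * g k j))"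
      by (intro sum.cong refl E1 j)
    also have "\<dots> = vol + (\<Sum>i\<in>V. deg i * g i j)"
      by (simp add: sum.distrib sum_swap vol_def)
    finally have "(\<Sum>i\<in>V. deg i * h i j) = vol + (\<Sum>i\<in>V. deg i * g i j)" .
    moreover have "(\<Sum>i\<in>V. deg i * h i j) = (\<Sum>i\<in>V. deg i * g i j) + (\<Sum>i\<in>V. if i = j then deg j * h j j else 0)"
      unfolding sum.distrib[symmetric] by (intro sum.cong refl) (auto simp: g_def)
    ultimately show ?thesis using j finite_V by simp
  qed
  \<comment> \<open>The Poisson equation for \<open>g\<close> in its first argument: sources
    \<open>deg i\<close> everywhere and a sink of mass \<open>vol\<close> at the target.\<close>
  have E2: "(\<Sum>k\<in>V. a i k * (g i j - g k j)) = deg i - (if i = j then vol else 0)" if "i \<in> V" "j \<in> V" for i j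
  proof -
    have "(\<Sum>k\<in>V. a i k * (g i j - g k j)) = deg i * g i j - (\<Sum>k\<in>V. a i k * g k j)"
      by (simp add: deg_def right_diff_distrib sum_subtractf sum_distrib_right)
    then show ?thesis using E1[OF that] return[OF that(2)] by (auto simp: g_def)
  qed
  \<comment> \<open>\<open>F i\<close> is \<open>vol\<close> times the stationary average of
    \<open>g i j\<close> over targets \<open>j\<close>. Averaging cancels sources against sinks, so
    \<open>F\<close> is harmonic and equals the constant \<open>M\<close>.\<close>
  define F where "F i = (\<Sum>j\<in>V. deg j * g i j)" for i
  define M where "M = (\<Sum>i\<in>V. deg i * F i) / vol"
  have "(\<Sum>k\<in>V. a i k * (F i - F k)) = 0" if i: "i \<in> V" for i
  proof -
    have "(\<Sum>k\<in>V. a i k * (F i - F k)) = (\<Sum>j\<in>V. deg j * (\<Sum>k\<in>V. a i k * (g i j - g k j)))"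
      unfolding F_def sum_subtractf[symmetric] sum_distrib_left
      by (subst sum.swap) (simp add: algebra_simps)
    also have "\<dots> = (\<Sum>j\<in>V. deg j * deg i - (if i = j then deg i * vol else 0))"
      by (intro sum.cong refl, subst E2[OF i]) (auto simp: algebra_simps)
    also have "\<dots> = 0"
      using i finite_V by (simp add: sum_subtractf sum_distrib_right[symmetric] vol_def[symmetric])
    finally show ?thesis .
  qed
  then have "energy F = 0" by (simp add: energy_eq)
  then have F: "F i = M" if "i \<in> V" for i
    using energy_0_imp_constant that by (simp add: M_def)
  \<comment> \<open>The extra 1 is the target \<open>j = i\<close>: its mean return time times its
    stationary probability.\<close>
  have H: "H = M / vol + 1"
  proof -
    have "vol * H = (\<Sum>j\<in>V. deg j * h i j)"
      using vol_pos by (simp add: H_def sum_distrib_left)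
    also have "\<dots> = (\<Sum>j\<in>V. deg j * g i j + (if i = j then deg i * h i i else 0))"
      by (intro sum.cong refl) (auto simp: g_def)
    also have "\<dots> = M + vol"
      using \<open>i \<in> V\<close> finite_V F[OF \<open>i \<in> V\<close>] return by (simp add: sum.distrib F_def)
    finally show ?thesis using vol_pos by (simp add: field_simps)
  qed
  define t where "t j = (\<Sum>i\<in>V. deg i * g i j) / vol" for j
  define f where "f j i = g i j - t j" for i j
  have f_mean: "(\<Sum>i\<in>V. deg i * f j i) = 0" for j
    unfolding f_def right_diff_distrib sum_subtractf sum_deg_const t_def using vol_pos by simp
  have f_lap: "(\<Sum>k\<in>V. a i k * (f j i - f j k)) = deg i - (if i = j then vol else 0)" if "i \<in> V" "j \<in> V" for i j
    using E2[OF that] by (simp add: f_def)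
  have f_diag: "f j j = - t j" for j by (simp add: f_def g_def)
  \<comment> \<open>In the Green identity the sources pair to zero with the centred function, and
    only the sink, where \<open>f j j\<close> is \<open>- t j\<close>, contributes.\<close>
  have f_energy: "energy (f j) = vol * t j" if j: "j \<in> V" for j
  proof -
    have "energy (f j) = (\<Sum>i\<in>V. deg i * f j i - (if i = j then vol * f j j else 0))"
      unfolding energy_eq by (intro sum.cong refl, subst f_lap[OF _ j]) (auto simp: algebra_simps)
    then show ?thesis using f_mean[of j] j finite_V f_diag by (simp add: sum_subtractf)
  qed
  define Err where "Err = (\<Sum>j\<in>V. \<Sum>k\<in>V. a j k * f j k)"
  have M_t: "(\<Sum>j\<in>V. deg j * t j) = M"
    unfolding M_def F_def t_def sum_divide_distrib sum_distrib_left times_divide_eq_right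
    by (subst sum.swap) (simp add: mult_ac)
  \<comment> \<open>This is the Poisson equation read at the target itself and summed over all
    targets.\<close>
  have Err: "Err = (?N - 1) * vol - M"
  proof -
    have "(\<Sum>k\<in>V. a j k * f j k) = vol - deg j - deg j * t j" if j: "j \<in> V" for j
    proof -
      have "(\<Sum>k\<in>V. a j k * (f j j - f j k)) = deg j * f j j - (\<Sum>k\<in>V. a j k * f j k)"
        by (simp add: deg_def right_diff_distrib sum_subtractf sum_distrib_right)
      then show ?thesis using f_lap[OF j j] f_diag by simp
    qed
    then have "Err = (\<Sum>j\<in>V. vol - deg j - deg j * t j)"
      unfolding Err_def by (intro sum.cong refl)
    then show ?thesis
      unfolding sum_subtractf M_t vol_def[symmetric] by (simp add: algebra_simps)
  qed
  \<comment> \<open>With this normalisation the squares of \<open>?r\<close> sum to the trace of the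
    squared transition matrix, and those of \<open>?s\<close> to degree-weighted norms of the
    functions \<open>f j\<close>.\<close>
  let ?r = "\<lambda>(j, k). a j k / sqrt (deg j * deg k)" and ?s = "\<lambda>(j, k). sqrt (deg j * deg k) * f j k"
  have "Err = (\<Sum>p\<in>V \<times> V. ?r p * ?s p)"
    unfolding Err_def sum.cartesian_product
  proof (intro sum.cong refl, clarify)
    fix j k assume "j \<in> V" "k \<in> V"
    then have "sqrt (deg j * deg k) \<noteq> 0" using deg_pos by fastforce
    then show "a j k * f j k = a j k / sqrt (deg j * deg k) * (sqrt (deg j * deg k) * f j k)" by simp
  qed
  then have "Err\<^sup>2 \<le> (\<Sum>p\<in>V \<times> V. (?r p)\<^sup>2) * (\<Sum>p\<in>V \<times> V. (?s p)\<^sup>2)"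
    using Cauchy_Schwarz_ineq_sum[of ?r ?s "V \<times> V"] by simp
  also have "\<dots> \<le> (?N / \<beta>) * (2 * \<Delta>\<^sup>2 * vol * M / \<beta>\<^sup>2)"
  proof (rule mult_mono)
    have "(\<Sum>p\<in>V \<times> V. (?r p)\<^sup>2) = (\<Sum>j\<in>V. \<Sum>k\<in>V. (a j k)\<^sup>2 / (deg j * deg k))"
      unfolding sum.cartesian_product using deg_pos
      by (intro sum.cong refl) (force simp: power_divide less_imp_le)
    \<comment> \<open>Weights at most 1 absorb one power of \<open>a j k\<close>, and one degree is
      bounded below by \<beta>; then each row sums to \<open>1 / \<beta>\<close>.\<close>
    also have "\<dots> \<le> (\<Sum>j\<in>V. \<Sum>k\<in>V. a j k / (deg j * \<beta>))"
      using deg_pos deg_ge \<beta>_pos nonneg le_1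
      by (intro sum_mono frac_le mult_pos_pos mult_left_mono) (auto simp: power2_eq_square mult_left_le less_imp_le)
    also have "\<dots> = (\<Sum>j\<in>V. 1 / \<beta>)"
      by (intro sum.cong refl) (use deg_pos in \<open>force simp: sum_divide_distrib[symmetric] deg_def[symmetric]\<close>)
    finally show "(\<Sum>p\<in>V \<times> V. (?r p)\<^sup>2) \<le> ?N / \<beta>" by simp
    have "(\<Sum>p\<in>V \<times> V. (?s p)\<^sup>2) = (\<Sum>j\<in>V. \<Sum>k\<in>V. deg j * deg k * (f j k)\<^sup>2)"
      unfolding sum.cartesian_product using deg_pos
      by (intro sum.cong refl) (force simp: power_mult_distrib less_imp_le)
    also have "\<dots> = (\<Sum>j\<in>V. deg j * (\<Sum>k\<in>V. deg k * (f j k)\<^sup>2))"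
      by (simp add: sum_distrib_left mult_ac)
    also have "\<dots> \<le> (\<Sum>j\<in>V. deg j * (2 * \<Delta>\<^sup>2 * (vol * t j) / \<beta>\<^sup>2))"
    proof (intro sum_mono mult_left_mono)
      fix j assume j: "j \<in> V"
      show "(\<Sum>k\<in>V. deg k * (f j k)\<^sup>2) \<le> 2 * \<Delta>\<^sup>2 * (vol * t j) / \<beta>\<^sup>2"
        using poincare[OF f_mean[of j]] \<beta>_pos f_energy[OF j] by (simp add: field_simps)
      show "0 \<le> deg j" using deg_pos[OF j] by simp
    qed
    also have "\<dots> = 2 * \<Delta>\<^sup>2 * vol * M / \<beta>\<^sup>2"
      unfolding M_t[symmetric] by (simp add: sum_distrib_left sum_divide_distrib mult_ac)
    finally show "(\<Sum>p\<in>V \<times> V. (?s p)\<^sup>2) \<le> 2 * \<Delta>\<^sup>2 * vol * M / \<beta>\<^sup>2" .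
  qed (use \<beta>_pos in \<open>auto intro!: sum_nonneg\<close>)
  also have "\<dots> = vol\<^sup>2 * (\<delta> * ?N * (M / vol))"
    using vol_pos by (simp add: \<delta>_def power2_eq_square power3_eq_cube)
  also have "\<dots> \<le> vol\<^sup>2 * (\<delta> * ?N * H)"
    using \<beta>_pos by (intro mult_left_mono) (auto simp: H \<delta>_def)
  also have "Err = - (vol * (H - ?N))"
    using vol_pos by (simp add: Err H field_simps)
  finally show ?thesis
    using vol_pos by (simp add: power_mult_distrib)
qed

section \<open>Finiteness of the mean hitting times\<close>

text \<open>By symmetry of \<open>a\<close>, the indicator of an edge-closed set has zero energy,
  hence is constant.\<close>

lemma connected:
  assumes "j \<in> S" "j \<in> V" "i \<in> V"
    and closed: "\<And>i k. i \<in> S \<Longrightarrow> i \<in> V \<Longrightarrow> k \<in> V \<Longrightarrow> a i k \<noteq> 0 \<Longrightarrow> k \<in> S"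
  shows "i \<in> S"
proof -
  define f :: "'a \<Rightarrow> real" where "f i = of_bool (i \<in> S)" for i
  have "a i k * (f i - f k)\<^sup>2 = 0" if "i \<in> V" "k \<in> V" for i k
    using closed[of i k] closed[of k i] that by (auto simp: f_def sym)
  then have "(\<Sum>i\<in>V. \<Sum>k\<in>V. a i k * (f i - f k)\<^sup>2) = 0"
    by (intro sum.neutral ballI)
  then have "energy f = 0" by (simp add: energy_def)
  then have "f i = f j" using energy_0_imp_constant assms by metis
  then show ?thesis using assms by (simp add: f_def split: if_splits)
qed

text \<open>Real-valued counterpart of \<open>avoid\<close>, with step probabilities
  \<open>a i k / deg i\<close>.\<close>

primrec survival :: "'a \<Rightarrow> nat \<Rightarrow> 'a \<Rightarrow> real" where
  "survival j 0 i = 1"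
| "survival j (Suc n) i = (\<Sum>k\<in>V. a i k * (if k = j then 0 else survival j n k)) / deg i"

lemma survival_nonneg: "0 \<le> survival j n i"
proof (induction n arbitrary: i)
  case (Suc n)
  then show ?case
    by (auto intro!: divide_nonneg_nonneg sum_nonneg mult_nonneg_nonneg nonneg simp: deg_def)
qed simp

text \<open>The return time to \<open>j\<close> is controlled first: with the truncated expectations
  \<open>s m\<close>, stationarity turns \<open>s m \<le> s (Suc m)\<close> into \<open>deg j * s m j \<le> vol\<close>. Finiteness then
  propagates from \<open>j\<close> along the edges.\<close>

lemma summable_survival:
  assumes j: "j \<in> V" and "i \<in> V"
  shows "summable (\<lambda>n. survival j n i)"
proof -
  \<comment> \<open>\<open>s m i\<close> is the mean of the hitting time truncated at
    \<open>m\<close>, by the tail-sum formula.\<close>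
  define s where "s m i = (\<Sum>n<m. survival j n i)" for m i
  have s_Suc: "s (Suc m) i = 1 + (\<Sum>k\<in>V. a i k * (if k = j then 0 else s m k)) / deg i" for m i
  proof -
    have "(\<Sum>n<m. survival j (Suc n) i) = (\<Sum>k\<in>V. a i k * (if k = j then 0 else s m k)) / deg i"
      unfolding survival.simps sum_divide_distrib[symmetric]
      by (subst sum.swap) (auto simp: s_def sum_distrib_left intro!: sum.cong arg_cong2[where f = "(/)"])
    then show ?thesis
      unfolding s_def by (subst sum.lessThan_Suc_shift) simp
  qed
  have "deg j * s m j \<le> vol" for m
  proof -
    have "(\<Sum>k\<in>V. deg k * s m k) \<le> (\<Sum>k\<in>V. deg k * s (Suc m) k)"
      by (intro sum_mono mult_left_mono) (auto simp: s_def survival_nonneg deg_nonneg)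
    also have "\<dots> = (\<Sum>i\<in>V. deg i + (\<Sum>k\<in>V. a i k * (if k = j then 0 else s m k)))"
    proof (intro sum.cong refl)
      fix i assume "i \<in> V"
      then show "deg i * s (Suc m) i = deg i + (\<Sum>k\<in>V. a i k * (if k = j then 0 else s m k))"
        unfolding s_Suc using deg_pos[of i] by (simp add: distrib_left)
    qed
    also have "\<dots> = vol + (\<Sum>k\<in>V. deg k * (if k = j then 0 else s m k))"
      unfolding sum.distrib sum_swap vol_def ..
    also have "(\<Sum>k\<in>V. deg k * (if k = j then 0 else s m k)) =
        (\<Sum>k\<in>V. deg k * s m k - (if k = j then deg j * s m j else 0))"
      by (intro sum.cong) auto
    also have "\<dots> = (\<Sum>k\<in>V. deg k * s m k) - deg j * s m j"
      using j finite_V by (simp add: sum_subtractf)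
    finally show ?thesis by simp
  qed
  then have "s m j \<le> vol / deg j" for m
    using deg_pos[OF j] by (simp add: field_simps)
  then have "summable (\<lambda>n. survival j n j)"
    unfolding s_def by (intro summableI_nonneg_bounded[where x = "vol / deg j"] survival_nonneg)
  then have "j \<in> {i. summable (\<lambda>n. survival j n i)}" by simp
  then have "i \<in> {i. summable (\<lambda>n. survival j n i)}"
  proof (rule connected[OF _ j \<open>i \<in> V\<close>])
    fix i k
    assume i: "i \<in> {i. summable (\<lambda>n. survival j n i)}" "i \<in> V" and k: "k \<in> V" "a i k \<noteq> 0"
    show "k \<in> {i. summable (\<lambda>n. survival j n i)}"
    proof (cases "k = j")
      case False
      have pos: "0 < a i k" using k nonneg[of i k] by linarith
      \<comment> \<open>Stepping from \<open>i\<close> to \<open>k\<close> and then avoiding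
        \<open>j\<close> is one way of avoiding \<open>j\<close> from \<open>i\<close>, so the
        shifted series at \<open>i\<close>, divided by the step probability, dominates the series at
        \<open>k\<close>.\<close>
      have "summable (\<lambda>n. deg i / a i k * survival j (Suc n) i)"
        using i summable_Suc_iff[of "\<lambda>n. survival j n i"] by (intro summable_mult) simp
      then have "summable (\<lambda>n. survival j n k)"
      proof (rule summable_comparison_test'[where N = 0])
        fix n
        have "a i k * (if k = j then 0 else survival j n k) \<le>
            (\<Sum>k\<in>V. a i k * (if k = j then 0 else survival j n k))"
          using k finite_V by (intro member_le_sum) (auto simp: nonneg survival_nonneg)
        then show "norm (survival j n k) \<le> deg i / a i k * survival j (Suc n) i"
          using False pos deg_pos[OF i(2)] by (simp add: survival_nonneg field_simps)
      qed
      then show ?thesis by simp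
    qed (use \<open>summable (\<lambda>n. survival j n j)\<close> in simp)
  qed
  then show ?thesis by simp
qed

text \<open>On \<open>V\<close> the series converges by \<open>summable_survival\<close>, so there
  the value is a genuine expectation and not a default of \<open>suminf\<close>.\<close>

definition hit :: "'a \<Rightarrow> 'a \<Rightarrow> real" where
  "hit i j = (\<Sum>n. survival j n i)"

lemma hit_nonneg: "i \<in> V \<Longrightarrow> j \<in> V \<Longrightarrow> 0 \<le> hit i j"
  unfolding hit_def by (intro suminf_nonneg summable_survival survival_nonneg)

lemma hit_rec:
  assumes "i \<in> V" "j \<in> V"
  shows "hit i j = 1 + (\<Sum>k\<in>V. a i k * (if k = j then 0 else hit k j)) / deg i"
proof -
  have "(\<lambda>n. a i k * (if k = j then 0 else survival j n k)) sums (a i k * (if k = j then 0 else hit k j))"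
    if "k \<in> V" for k
    using summable_sums[OF summable_survival[OF assms(2) that]] by (auto intro!: sums_mult simp: hit_def)
  then have "(\<lambda>n. survival j (Suc n) i) sums ((\<Sum>k\<in>V. a i k * (if k = j then 0 else hit k j)) / deg i)"
    unfolding survival.simps by (intro sums_divide sums_sum)
  from sums_unique[OF this] show ?thesis
    using suminf_split_head[OF summable_survival[OF assms(2,1)]] by (simp add: hit_def)
qed

end

section \<open>Graphs as expanders\<close>

abbreviation adj :: "nat set set \<Rightarrow> nat \<Rightarrow> nat \<Rightarrow> real" where
  "adj E i j \<equiv> of_bool ({i, j} \<in> E)"

lemma vertex_pairsD:
  assumes "E \<subseteq> vertex_pairs N" "{i, j} \<in> E"
  shows "i < N" "j < N" "i \<noteq> j"
  using assms by (auto simp: vertex_pairs_def card_insert_if split: if_splits)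

lemma neighbours_subset: "E \<subseteq> vertex_pairs N \<Longrightarrow> neighbours E i \<subseteq> {..<N}"
  by (auto simp: neighbours_def dest: vertex_pairsD)

lemma finite_neighbours: "E \<subseteq> vertex_pairs N \<Longrightarrow> finite (neighbours E i)"
  by (rule finite_subset[OF neighbours_subset]) auto

lemma finite_vertex_pairs: "finite (vertex_pairs N)"
  unfolding vertex_pairs_def by (rule finite_subset[of _ "Pow {..<N}"]) auto

lemma sum_adj:
  assumes "E \<subseteq> vertex_pairs N"
  shows "(\<Sum>k<N. adj E i k * f k) = (\<Sum>k\<in>neighbours E i. f k)"
proof -
  have "(\<Sum>k<N. adj E i k * f k) = (\<Sum>k<N. if k \<in> neighbours E i then f k else 0)"
    by (intro sum.cong) (auto simp: neighbours_def)
  also have "\<dots> = (\<Sum>k\<in>neighbours E i. f k)"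
    using neighbours_subset[OF assms] by (simp add: sum.If_cases Int_absorb1)
  finally show ?thesis .
qed

lemma sum_adj_degree:
  "E \<subseteq> vertex_pairs N \<Longrightarrow> (\<Sum>k<N. adj E i k) = vertex_degree E i"
  using sum_adj[of E N i "\<lambda>_. 1"] by (simp add: vertex_degree_def)

text \<open>Handshake lemma by double counting of incidences; it matches the normalisation of
  \<open>stationary\<close> with \<open>vol\<close>.\<close>

lemma sum_vertex_degree:
  assumes E: "E \<subseteq> vertex_pairs N"
  shows "(\<Sum>i<N. vertex_degree E i) = 2 * card E"
proof -
  have fin: "finite E" using E finite_vertex_pairs finite_subset by blast
  have deg: "vertex_degree E i = (\<Sum>e\<in>E. of_bool (i \<in> e))" if "i < N" for i
  proof -
    have "(\<lambda>j. {i, j}) ` neighbours E i = {e \<in> E. i \<in> e}"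
    proof safe
      fix e assume e: "e \<in> E" "i \<in> e"
      then have "card e = 2" using E by (auto simp: vertex_pairs_def)
      then obtain j where "e = {i, j}" using e(2) by (auto simp: card_2_iff)
      then show "e \<in> (\<lambda>j. {i, j}) ` neighbours E i" using e by (auto simp: neighbours_def)
    qed (auto simp: neighbours_def)
    moreover have "inj_on (\<lambda>j. {i, j}) (neighbours E i)"
      by (auto simp: inj_on_def doubleton_eq_iff)
    ultimately have "vertex_degree E i = card {e \<in> E. i \<in> e}"
      unfolding vertex_degree_def by (metis card_image)
    then show ?thesis using fin by (simp add: Int_def)
  qed
  have "(\<Sum>i<N. vertex_degree E i) = (\<Sum>e\<in>E. \<Sum>i<N. of_bool (i \<in> e))"
    by (subst sum.swap) (simp add: deg)
  also have "\<dots> = (\<Sum>e\<in>E. 2)"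
  proof (intro sum.cong refl)
    fix e assume "e \<in> E"
    then have "e \<subseteq> {..<N}" "card e = 2" using E by (auto simp: vertex_pairs_def)
    then show "(\<Sum>i<N. of_bool (i \<in> e)) = (2::nat)" by (simp add: Int_absorb1)
  qed
  finally show ?thesis by simp
qed

section \<open>Transfer from weighted graphs to the random walk\<close>

context
  fixes N :: nat and E :: "nat set set" and \<beta> \<Delta> :: real
  assumes E: "E \<subseteq> vertex_pairs N"
    and expander: "expander {..<N} (adj E) \<beta> \<Delta>"
begin

interpretation expander "{..<N}" "adj E" \<beta> \<Delta>
  by (rule expander)

lemma deg_eq: "deg i = vertex_degree E i"
  using sum_adj_degree[OF E] by (simp add: deg_def)

lemma stationary_eq: "stationary E i = deg i / vol"
  using sum_vertex_degree[OF E] unfolding stationary_def vol_def deg_eq of_nat_sum[symmetric] by simp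

text \<open>Positive degrees make each step uniform on the neighbours, so the two recursions
  agree.\<close>

lemma avoid_eq_survival: "i < N \<Longrightarrow> avoid E j n i = ennreal (survival j n i)"
proof (induction n arbitrary: i)
  case (Suc n)
  let ?f = "\<lambda>k. if k = j then 0 else survival j n k"
  have "vertex_degree E i > 0" using deg_pos[of i] Suc.prems by (simp add: deg_eq)
  then have ne: "neighbours E i \<noteq> {}" by (auto simp: vertex_degree_def)
  have "avoid E j (Suc n) i = (\<Sum>k\<in>neighbours E i. if k = j then 0 else avoid E j n k) / vertex_degree E i"
    using ne finite_neighbours[OF E, of i] by (simp add: walk_step_def nn_integral_pmf_of_set vertex_degree_def)
  also have "(\<Sum>k\<in>neighbours E i. if k = j then 0 else avoid E j n k) = (\<Sum>k\<in>neighbours E i. ennreal (?f k))"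
    using Suc.IH neighbours_subset[OF E, of i] by (intro sum.cong) auto
  also have "\<dots> = ennreal (\<Sum>k\<in>neighbours E i. ?f k)"
    by (intro sum_ennreal) (auto simp: survival_nonneg)
  also have "\<dots> / vertex_degree E i = ennreal ((\<Sum>k\<in>neighbours E i. ?f k) / vertex_degree E i)"
    using \<open>vertex_degree E i > 0\<close>
    by (auto simp: ennreal_of_nat_eq_real_of_nat survival_nonneg intro!: divide_ennreal sum_nonneg)
  finally show ?case
    by (simp add: sum_adj[OF E] deg_eq)
qed simp

lemma mean_hitting_time_eq_hit:
  assumes "i < N" "j < N"
  shows "mean_hitting_time E i j = ennreal (hit i j)"
  using assms summable_survival[of j i]
  by (simp add: mean_hitting_time_eq_suminf avoid_eq_survival hit_def suminf_ennreal2 survival_nonneg)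

text \<open>The vertices reachable from \<open>i\<close> form an edge-closed set, to which
  \<open>connected\<close> applies.\<close>

lemma expander_connected_graph: "connected_graph N E"
  unfolding connected_graph_def
proof (intro allI impI)
  fix i j assume ij: "i < N" "j < N"
  define R where "R = {(u, v). {u, v} \<in> E}"
  have "j \<in> R\<^sup>* `` {i}"
  proof (rule connected)
    show "i \<in> R\<^sup>* `` {i}" by simp
    fix u v
    assume u: "u \<in> R\<^sup>* `` {i}" and "adj E u v \<noteq> 0"
    then have "(u, v) \<in> R" by (simp add: R_def)
    with u show "v \<in> R\<^sup>* `` {i}" by (auto intro: rtrancl_into_rtrancl)
  qed (use ij in simp_all)
  then show "(i, j) \<in> {(u, v). {u, v} \<in> E}\<^sup>*" by (simp add: R_def)
qed

text \<open>For the relative error \<open>z\<close>, \<open>random_target\<close> gives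
  \<open>z\<^sup>2 \<le> \<delta> * (z + 1)\<close>, since \<open>H / N \<le> z + 1\<close>. Solving
  this for \<open>z\<close> yields the bound.\<close>

lemma expander_random_starting_time:
  assumes "i < N"
  defines "\<delta> \<equiv> 2 * \<Delta>\<^sup>2 / \<beta> ^ 3"
  shows "\<bar>enn2ereal (random_starting_time N E i) / ereal (real N) - 1\<bar> \<le> ereal (\<delta> + sqrt \<delta>)"
proof -
  define H where "H = (\<Sum>j<N. deg j / vol * hit i j)"
  have nn: "0 \<le> deg j / vol * hit i j" if "j < N" for j
    using that assms(1) vol_pos by (auto intro!: mult_nonneg_nonneg divide_nonneg_pos deg_nonneg hit_nonneg)
  then have "0 \<le> H" by (auto simp: H_def intro!: sum_nonneg)
  have "random_starting_time N E i = (\<Sum>j<N. ennreal (deg j / vol * hit i j))"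
    unfolding random_starting_time_def
  proof (intro sum.cong refl)
    fix j assume "j \<in> {..<N}"
    then show "ennreal (stationary E j) * mean_hitting_time E i j = ennreal (deg j / vol * hit i j)"
      using assms(1) vol_pos hit_nonneg[of i j] deg_nonneg[of j]
      by (subst ennreal_mult) (simp_all add: stationary_eq mean_hitting_time_eq_hit)
  qed
  also have "\<dots> = ennreal H"
    unfolding H_def using nn by (intro sum_ennreal) auto
  finally have rst: "enn2ereal (random_starting_time N E i) = ereal H"
    using \<open>0 \<le> H\<close> by simp
  have N: "real N > 0" using assms(1) by simp
  have \<delta>: "0 \<le> \<delta>" using \<beta>_pos by (simp add: \<delta>_def)
  define z where "z = \<bar>H / N - 1\<bar>"
  have "(H - N)\<^sup>2 \<le> \<delta> * N * H"
    using random_target[of hit i] hit_rec assms(1) by (simp add: H_def \<delta>_def)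
  then have "(H - N)\<^sup>2 / (real N)\<^sup>2 \<le> \<delta> * N * H / (real N)\<^sup>2"
    by (rule divide_right_mono) simp
  moreover have "z\<^sup>2 = (H - N)\<^sup>2 / (real N)\<^sup>2"
    using N by (simp add: z_def diff_divide_distrib flip: power_divide)
  ultimately have "z\<^sup>2 \<le> \<delta> * (H / N)"
    using N by (simp add: power2_eq_square)
  also have "\<dots> \<le> \<delta> * (z + 1)"
    using \<delta> by (intro mult_left_mono) (auto simp: z_def)
  finally have z: "z * (z - \<delta>) \<le> \<delta>"
    by (simp add: power2_eq_square algebra_simps)
  have "z \<le> \<delta> + sqrt \<delta>"
  proof (rule ccontr)
    assume "\<not> z \<le> \<delta> + sqrt \<delta>"
    \<comment> \<open>Both factors \<open>z\<close> and \<open>z - \<delta>\<close> would exceed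
      \<open>sqrt \<delta>\<close>, so their product would exceed \<delta>.\<close>
    then have "sqrt \<delta> < z" "sqrt \<delta> < z - \<delta>" using \<delta> by auto
    then have "sqrt \<delta> * sqrt \<delta> < z * (z - \<delta>)"
      using \<delta> by (intro mult_strict_mono') auto
    with z \<delta> show False by simp
  qed
  then show ?thesis
    unfolding rst using N by (simp add: z_def one_ereal_def)
qed

end

section \<open>Expansion of the random graph\<close>

lemma set_pmf_gnp: "E \<in> set_pmf (gnp N p) \<Longrightarrow> E \<subseteq> vertex_pairs N"
  by (auto simp: gnp_def)

lemma finite_set_pmf_gnp: "finite (set_pmf (gnp N p))"
  by (rule finite_subset[of _ "Pow (vertex_pairs N)"]) (auto dest: set_pmf_gnp simp: finite_vertex_pairs)

text \<open>Moment generating function of a binomial variable: the exponential is a product over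
  independent pairs, and pairs outside \<open>F\<close> contribute 1.\<close>

lemma expectation_exp_card_gnp:
  fixes p t :: real
  assumes F: "F \<subseteq> vertex_pairs N" and p: "0 \<le> p" "p \<le> 1"
  shows "measure_pmf.expectation (gnp N p) (\<lambda>E. exp (t * card (E \<inter> F))) = (1 + p * (exp t - 1)) ^ card F"
proof -
  let ?V = "vertex_pairs N"
  let ?w = "\<lambda>e b. if e \<in> F \<and> b then exp t else 1"
  have "exp (t * card ({e \<in> ?V. f e} \<inter> F)) = (\<Prod>e\<in>?V. ?w e (f e))" for f
  proof -
    have "(\<Prod>e\<in>?V. ?w e (f e)) = exp t ^ card {e \<in> ?V. e \<in> F \<and> f e}"
      using finite_vertex_pairs by (simp add: prod.If_cases Int_def)
    also have "{e \<in> ?V. e \<in> F \<and> f e} = {e \<in> ?V. f e} \<inter> F" by auto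
    finally show ?thesis by (simp add: mult.commute[of t] exp_of_nat_mult)
  qed
  then have "measure_pmf.expectation (gnp N p) (\<lambda>E. exp (t * card (E \<inter> F))) =
      measure_pmf.expectation (Pi_pmf ?V False (\<lambda>_. bernoulli_pmf p)) (\<lambda>f. \<Prod>e\<in>?V. ?w e (f e))"
    by (simp add: gnp_def)
  also have "\<dots> = (\<Prod>e\<in>?V. measure_pmf.expectation (bernoulli_pmf p) (?w e))"
    by (rule expectation_prod_Pi_pmf)
       (auto simp: finite_vertex_pairs intro!: integrable_measure_pmf_finite)
  also have "\<dots> = (\<Prod>e\<in>?V. if e \<in> F then 1 + p * (exp t - 1) else 1)"
    using p by (intro prod.cong refl) (auto simp: algebra_simps)
  also have "\<dots> = (1 + p * (exp t - 1)) ^ card F"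
    using F finite_vertex_pairs by (simp add: prod.If_cases Int_absorb1)
  finally show ?thesis .
qed

text \<open>Markov's inequality for the exponential, followed by \<open>1 + y \<le> exp y\<close>.
  The sign of \<open>t\<close> selects the tail: negative for the lower, positive for the
  upper.\<close>

lemma chernoff_gnp:
  fixes p s t :: real
  assumes F: "F \<subseteq> vertex_pairs N" and p: "0 \<le> p" "p \<le> 1"
  shows "measure_pmf.prob (gnp N p) {E. s \<le> t * card (E \<inter> F)} \<le> exp (card F * p * (exp t - 1) - s)"
proof -
  have int: "integrable (measure_pmf (gnp N p)) f" for f :: "nat set set \<Rightarrow> real"
    by (rule integrable_measure_pmf_finite[OF finite_set_pmf_gnp])
  have "measure_pmf.prob (gnp N p) {E. s \<le> t * card (E \<inter> F)} =
      measure_pmf.expectation (gnp N p) (indicator {E. s \<le> t * card (E \<inter> F)})"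
    by simp
  also have "\<dots> \<le> measure_pmf.expectation (gnp N p) (\<lambda>E. exp (t * card (E \<inter> F)) / exp s)"
    by (intro integral_mono int) (auto simp: indicator_def)
  also have "\<dots> = (1 + p * (exp t - 1)) ^ card F / exp s"
    using expectation_exp_card_gnp[OF assms] by simp
  also have "\<dots> \<le> exp (p * (exp t - 1)) ^ card F / exp s"
  proof (intro divide_right_mono power_mono)
    \<comment> \<open>Monotonicity of powers needs a nonnegative base; for negative \<open>t\<close>
      this rests on \<open>p \<le> 1\<close>.\<close>
    have "p * (1 - exp t) \<le> 1 * 1" if "exp t \<le> 1"
      using p that by (intro mult_mono) auto
    moreover have "p * (1 - exp t) \<le> 0" if "exp t \<ge> 1"
      using p that by (simp add: mult_nonneg_nonpos)
    ultimately show "0 \<le> 1 + p * (exp t - 1)"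
      by (smt (verit) mult_minus_right)
  qed auto
  also have "\<dots> = exp (card F * p * (exp t - 1) - s)"
    by (simp add: exp_diff exp_of_nat_mult[symmetric] mult_ac)
  finally show ?thesis .
qed

section \<open>Edge boundaries of vertex sets\<close>

definition crossing :: "nat \<Rightarrow> nat set \<Rightarrow> nat set set" where
  "crossing N S = (\<lambda>(i, j). {i, j}) ` (S \<times> ({..<N} - S))"

lemma inj_on_crossing: "inj_on (\<lambda>(i, j). {i, j}) (S \<times> ({..<N} - S))"
  by (auto simp: inj_on_def doubleton_eq_iff)

lemma crossing_subset: "S \<subseteq> {..<N} \<Longrightarrow> crossing N S \<subseteq> vertex_pairs N"
  by (auto simp: crossing_def vertex_pairs_def card_insert_if)

lemma card_crossing: "S \<subseteq> {..<N} \<Longrightarrow> card (crossing N S) = card S * (N - card S)"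
  unfolding crossing_def by (simp add: card_image[OF inj_on_crossing] card_cartesian_product card_Diff_subset
      finite_subset[of S "{..<N}"])

lemma sum_adj_crossing:
  assumes "S \<subseteq> {..<N}"
  shows "(\<Sum>i\<in>S. \<Sum>j\<in>{..<N} - S. adj E i j) = card (E \<inter> crossing N S)"
proof -
  have "finite (crossing N S)"
    using assms by (auto simp: crossing_def intro: finite_subset[of S "{..<N}"])
  have "(\<Sum>i\<in>S. \<Sum>j\<in>{..<N} - S. adj E i j) = (\<Sum>e\<in>crossing N S. of_bool (e \<in> E))"
    unfolding crossing_def sum.reindex[OF inj_on_crossing] sum.cartesian_product
    by (simp add: case_prod_beta)
  also have "\<dots> = card (E \<inter> crossing N S)"
    using \<open>finite (crossing N S)\<close> by (simp add: Int_def conj_commute)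
  finally show ?thesis .
qed

lemma sum_power_card_Pow: "finite A \<Longrightarrow> (\<Sum>S\<in>Pow A. x ^ card S) = (1 + x :: real) ^ card A"
  using prod_add[of A "\<lambda>_. x" "\<lambda>_. 1"] by (simp add: add.commute)

text \<open>Chernoff with \<open>t = -1\<close>: the mean is at least four times the threshold
  \<open>?c\<close>, so the exponent is at most \<open>- 2 * ?c + ?c\<close>. The bound is written
  as a power with exponent \<open>card S\<close> so that its sum over sets is a binomial
  expansion.\<close>

lemma prob_few_crossing:
  assumes S: "S \<subseteq> {..<N}" "2 * card S \<le> N" and p: "0 \<le> p" "p \<le> 1"
  shows "measure_pmf.prob (gnp N p) {E. card (E \<inter> crossing N S) \<le> real N * p / 8 * card S}
    \<le> exp (- (real N * p / 8)) ^ card S"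
proof -
  let ?c = "real N * p / 8 * card S"
  have "exp (-1) \<le> (1 / 2 :: real)"
    using exp_ge_add_one_self[of 1] by (simp add: exp_minus field_simps)
  have "real (card S) * (real N / 2) \<le> real (card S) * real (N - card S)"
    using S by (intro mult_left_mono) (auto simp: of_nat_diff)
  then have "real (card (crossing N S)) * p \<ge> real (card S) * (real N / 2) * p"
    using p by (intro mult_right_mono) (auto simp: card_crossing[OF S(1)])
  then have ge: "real (card (crossing N S)) * p \<ge> 4 * ?c" by (simp add: mult_ac)
  have "measure_pmf.prob (gnp N p) {E. card (E \<inter> crossing N S) \<le> ?c}
      = measure_pmf.prob (gnp N p) {E. - ?c \<le> (- 1 :: real) * card (E \<inter> crossing N S)}" by simp
  also have "\<dots> \<le> exp (card (crossing N S) * p * (exp (- 1) - 1) - - ?c)"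
    by (rule chernoff_gnp[OF crossing_subset[OF S(1)] p])
  also have "\<dots> \<le> exp (- ?c)"
  proof -
    have "card (crossing N S) * p * (exp (- 1) - 1) \<le> card (crossing N S) * p * (- 1 / 2)"
      using \<open>exp (-1) \<le> (1 / 2 :: real)\<close> p by (intro mult_left_mono) auto
    then show ?thesis using ge by simp
  qed
  also have "\<dots> = exp (- (real N * p / 8)) ^ card S"
    by (simp add: exp_of_nat_mult[symmetric] mult_ac)
  finally show ?thesis .
qed

text \<open>Chernoff with \<open>t = 1\<close>: the mean is at most \<open>N * p\<close> and
  \<open>exp 1 - 1 \<le> 2\<close>, so the exponent is at most \<open>- 2 * N * p\<close>. It is
  weakened to share its base with the lower tail.\<close>

lemma prob_large_degree:
  assumes i: "i < N" and p: "0 \<le> p" "p \<le> 1"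
  shows "measure_pmf.prob (gnp N p) {E. 4 * (real N * p) \<le> card (E \<inter> crossing N {i})}
    \<le> exp (- (real N * p / 8))"
proof -
  have sub: "{i} \<subseteq> {..<N}" using i by simp
  have "measure_pmf.prob (gnp N p) {E. 4 * (real N * p) \<le> card (E \<inter> crossing N {i})}
      \<le> exp (card (crossing N {i}) * p * (exp 1 - 1) - 4 * (real N * p))"
    using chernoff_gnp[OF crossing_subset[OF sub] p, of "4 * (real N * p)" 1] by simp
  also have "\<dots> \<le> exp (- (real N * p / 8))"
  proof -
    have "card (crossing N {i}) * p * (exp 1 - 1) \<le> (real N * p) * 2"
      using p exp_le by (intro mult_mono mult_right_mono) (auto simp: card_crossing[OF sub])
    moreover have "0 \<le> real N * p" using p by simp
    ultimately show ?thesis by simp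
  qed
  finally show ?thesis .
qed

text \<open>There are no loops, so a degree is the boundary size of a singleton and every condition
  becomes an edge count.\<close>

lemma expander_if_crossing:
  fixes \<beta> \<Delta> :: real
  assumes E: "E \<subseteq> vertex_pairs N" and "2 \<le> N" "0 < \<beta>"
    and cross: "\<And>S. S \<subseteq> {..<N} \<Longrightarrow> S \<noteq> {} \<Longrightarrow> 2 * card S \<le> N \<Longrightarrow> \<beta> * card S \<le> card (E \<inter> crossing N S)"
    and deg: "\<And>i. i < N \<Longrightarrow> card (E \<inter> crossing N {i}) \<le> \<Delta>"
  shows "expander {..<N} (adj E) \<beta> \<Delta>"
proof
  show "\<beta> * card S \<le> (\<Sum>i\<in>S. \<Sum>j\<in>{..<N} - S. adj E i j)" if "S \<subseteq> {..<N}" "2 * card S \<le> card {..<N}" for S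
    unfolding sum_adj_crossing[OF that(1)] using cross[of S] that by (cases "S = {}") simp_all
  show "(\<Sum>j<N. adj E i j) \<le> \<Delta>" if "i \<in> {..<N}" for i
  proof -
    have "adj E i i = 0" using vertex_pairsD(3)[OF E, of i i] by auto
    then have "(\<Sum>j<N. adj E i j) = (\<Sum>i\<in>{i}. \<Sum>j\<in>{..<N} - {i}. adj E i j)"
      by (subst sum.remove[of _ i]) (use that in auto)
    also have "\<dots> = card (E \<inter> crossing N {i})"
      using sum_adj_crossing[of "{i}" N E] that by simp
    also have "\<dots> \<le> \<Delta>" using deg[of i] that by simp
    finally show ?thesis .
  qed
qed (use assms in \<open>auto simp: insert_commute\<close>)

lemma prob_expander_gnp:
  assumes N: "2 \<le> N" and p: "0 < p" "p \<le> 1"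
  defines "x \<equiv> exp (- (real N * p / 8))"
  shows "measure_pmf.prob (gnp N p)
      {E. E \<subseteq> vertex_pairs N \<and> expander {..<N} (adj E) (real N * p / 8) (4 * (real N * p))}
    \<ge> 2 - exp (N * x) - N * x" (is "measure_pmf.prob _ ?G \<ge> _")
proof -
  let ?P = "measure_pmf.prob (gnp N p)"
  define few where "few S = {E. card (E \<inter> crossing N S) \<le> real N * p / 8 * card S}" for S
  define large where "large i = {E. 4 * (real N * p) \<le> card (E \<inter> crossing N {i})}" for i
  define \<S> where "\<S> = {S. S \<subseteq> {..<N} \<and> S \<noteq> {} \<and> 2 * card S \<le> N}"
  define B where "B = (\<Union>S\<in>\<S>. few S) \<union> (\<Union>i\<in>{..<N}. large i)"
  have fin: "finite \<S>" by (rule finite_subset[of _ "Pow {..<N}"]) (auto simp: \<S>_def)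
  \<comment> \<open>Restricting to the support guarantees that the outcome is a graph on the vertex
    set.\<close>
  have "- B \<inter> set_pmf (gnp N p) \<subseteq> ?G"
  proof
    fix E assume E: "E \<in> - B \<inter> set_pmf (gnp N p)"
    then have sub: "E \<subseteq> vertex_pairs N" using set_pmf_gnp by blast
    have "E \<notin> few S" if "S \<in> \<S>" for S using E that by (auto simp: B_def)
    moreover have "E \<notin> large i" if "i < N" for i using E that by (auto simp: B_def)
    ultimately have "expander {..<N} (adj E) (real N * p / 8) (4 * (real N * p))"
      using N p sub by (intro expander_if_crossing) (simp_all add: few_def large_def \<S>_def less_imp_le not_le)
    with sub show "E \<in> ?G" by simp
  qed
  then have "?P (- B) \<le> ?P ?G"
    using measure_pmf.finite_measure_mono[of "- B \<inter> set_pmf (gnp N p)" ?G "gnp N p"]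
    by (simp add: measure_Int_set_pmf)
  moreover have "?P (- B) = 1 - ?P B"
    using measure_pmf.prob_compl[of B "gnp N p"] by (simp add: Compl_eq_Diff_UNIV)
  moreover have "?P B \<le> (exp (N * x) - 1) + N * x"
  proof -
    have "?P B \<le> ?P (\<Union>S\<in>\<S>. few S) + ?P (\<Union>i\<in>{..<N}. large i)"
      unfolding B_def by (rule measure_Un_le) auto
    also have "?P (\<Union>S\<in>\<S>. few S) \<le> (\<Sum>S\<in>\<S>. ?P (few S))"
      using fin by (intro measure_UNION_le) auto
    also have "\<dots> \<le> (\<Sum>S\<in>\<S>. x ^ card S)"
      unfolding few_def x_def using p by (intro sum_mono prob_few_crossing) (auto simp: \<S>_def)
    \<comment> \<open>Admitting all nonempty sets makes the binomial theorem applicable; the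
      excluded empty set accounts for the subtracted 1.\<close>
    also have "\<dots> \<le> (\<Sum>S\<in>Pow {..<N} - {{}}. x ^ card S)"
      by (rule sum_mono2) (auto simp: \<S>_def x_def)
    also have "\<dots> = (1 + x) ^ N - 1"
      using sum_power_card_Pow[of "{..<N}" x] by (simp add: sum_diff1)
    also have "\<dots> \<le> exp x ^ N - 1"
      by (intro diff_right_mono power_mono) (auto simp: x_def)
    also have "exp x ^ N = exp (N * x)" by (simp add: exp_of_nat_mult)
    also have "?P (\<Union>i\<in>{..<N}. large i) \<le> (\<Sum>i<N. ?P (large i))"
      by (intro measure_UNION_le) auto
    also have "\<dots> \<le> (\<Sum>i<N. x)"
      unfolding large_def x_def using p by (intro sum_mono prob_large_degree) auto
    finally show ?thesis by simp
  qed
  ultimately show ?thesis by linarith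
qed

section \<open>Asymptotics of the error terms\<close>

theorem theorem2p3:
  fixes a\<^sub>0 a\<^sub>1 :: real and \<xi> :: "nat \<Rightarrow> real"
  assumes "a\<^sub>0 > 0" and "a\<^sub>1 \<ge> 10"
    and "eventually (\<lambda>N. 1 + a\<^sub>0 \<le> \<xi> N \<and> \<xi> N \<le> a\<^sub>1 * ln (ln (real N))) sequentially"
  shows "\<exists>C>0. \<forall>p :: nat \<Rightarrow> real.
    (\<forall>N. 0 \<le> p N \<and> p N \<le> 1) \<longrightarrow>
    eventually (\<lambda>N. p N > 0) sequentially \<longrightarrow>
    (\<lambda>N. ln (real N) powr (2 * C * \<xi> N) / (real N * p N)) \<longlonglongrightarrow> 0 \<longrightarrow>
    (\<exists>\<epsilon> :: nat \<Rightarrow> real. \<epsilon> \<longlonglongrightarrow> 0 \<and>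
      (\<lambda>N. measure_pmf.prob (gnp N (p N))
        {E. connected_graph N E \<and>
          (\<forall>i<N. \<bar>enn2ereal (random_starting_time N E i) / ereal (real N) - 1\<bar> \<le> ereal (\<epsilon> N))})
      \<longlonglongrightarrow> 1)"
  \<comment> \<open>As \<open>2 \<xi>\<^sub>N \<ge> 1\<close>, already \<open>C = 1\<close> forces \<open>N p\<close> to dominate \<open>ln N\<close>, which is all that is used.\<close>
proof (intro exI[of _ 1] conjI allI impI)
  fix p :: "nat \<Rightarrow> real"
  assume p: "\<forall>N. 0 \<le> p N \<and> p N \<le> 1" and p_pos: "eventually (\<lambda>N. p N > 0) sequentially"
    and lim: "(\<lambda>N. ln (real N) powr (2 * 1 * \<xi> N) / (real N * p N)) \<longlonglongrightarrow> 0"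
  define d where "d N = real N * p N" for N
  have ln_large: "eventually (\<lambda>N. ln (real N) \<ge> 1) sequentially" by real_asymp
  \<comment> \<open>The constant 16 makes \<open>exp (- d N / 8)\<close> at most
    \<open>1 / N\<^sup>2\<close>, so that \<open>N\<close> times it still tends to 0.\<close>
  have d_ge: "eventually (\<lambda>N. 16 * ln (real N) \<le> d N) sequentially"
  proof -
    have "eventually (\<lambda>N. ln (real N) powr (2 * 1 * \<xi> N) / d N < 1 / 16) sequentially"
      using lim unfolding d_def by (rule order_tendstoD) simp
    then show ?thesis
      using p_pos ln_large assms(3) eventually_gt_at_top[of 0]
    proof eventually_elim
      case (elim N)
      \<comment> \<open>Division by zero has value 0, so a small quotient bounds \<open>d N\<close>
        from below only together with its positivity.\<close>
      have "0 < d N" using elim by (simp add: d_def)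
      have "ln (real N) powr 1 \<le> ln (real N) powr (2 * 1 * \<xi> N)"
        using elim assms(1) by (intro powr_mono) auto
      also have "\<dots> < d N / 16" using elim(1) \<open>0 < d N\<close> by (simp add: field_simps)
      finally show ?case using elim by simp
    qed
  qed
  have d_lim: "filterlim d at_top sequentially"
    by (rule filterlim_at_top_mono[OF _ d_ge]) real_asymp
  \<comment> \<open>The error parameter for expansion \<open>d N / 8\<close> and degree bound
    \<open>4 * d N\<close>; the powers cancel to \<open>16384 / d N\<close>.\<close>
  define \<delta> where "\<delta> N = 2 * (4 * d N)\<^sup>2 / (d N / 8) ^ 3" for N
  define \<epsilon> where "\<epsilon> N = \<delta> N + sqrt (\<delta> N)" for N
  have "\<delta> = (\<lambda>N. 16384 * inverse (d N))"
    by (rule ext) (simp add: \<delta>_def power2_eq_square power3_eq_cube divide_simps)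
  then have "\<delta> \<longlonglongrightarrow> 0"
    using tendsto_mult_right_zero[OF tendsto_inverse_0_at_top[OF d_lim], of 16384] by simp
  then have "\<epsilon> \<longlonglongrightarrow> 0 + sqrt 0"
    unfolding \<epsilon>_def by (intro tendsto_intros)
  moreover define G where "G N = {E. connected_graph N E \<and>
          (\<forall>i<N. \<bar>enn2ereal (random_starting_time N E i) / ereal (real N) - 1\<bar> \<le> ereal (\<epsilon> N))}" for N
  have "(\<lambda>N. measure_pmf.prob (gnp N (p N)) (G N)) \<longlonglongrightarrow> 1"
  proof (rule tendsto_sandwich)
    show "eventually (\<lambda>N. 2 - exp (1 / real N) - 1 / real N \<le> measure_pmf.prob (gnp N (p N)) (G N)) sequentially"
      using d_ge p_pos eventually_ge_at_top[of 2]
    proof eventually_elim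
      case (elim N)
      define x where "x = exp (- (real N * p N / 8))"
      have "x \<le> exp (- (2 * ln (real N)))"
        using elim(1) by (simp add: x_def d_def)
      also have "\<dots> = 1 / (real N * real N)"
        using elim(3) by (simp only: exp_minus mult_2 exp_add inverse_eq_divide) simp
      finally have x: "N * x \<le> 1 / real N"
        using elim(3) by (simp add: field_simps)
      have "2 - exp (1 / real N) - 1 / real N \<le> 2 - exp (N * x) - N * x"
        using x by (smt (verit) exp_le_cancel_iff)
      also have "\<dots> \<le> measure_pmf.prob (gnp N (p N))
          {E. E \<subseteq> vertex_pairs N \<and> expander {..<N} (adj E) (real N * p N / 8) (4 * (real N * p N))}"
        unfolding x_def using elim p by (intro prob_expander_gnp) auto
      also have "\<dots> \<le> measure_pmf.prob (gnp N (p N)) (G N)"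
      proof (intro measure_pmf.finite_measure_mono subsetI)
        fix E
        assume "E \<in> {E. E \<subseteq> vertex_pairs N \<and>
            expander {..<N} (adj E) (real N * p N / 8) (4 * (real N * p N))}"
        then have "E \<subseteq> vertex_pairs N" "expander {..<N} (adj E) (d N / 8) (4 * d N)"
          by (auto simp: d_def)
        then show "E \<in> G N"
          unfolding G_def \<epsilon>_def \<delta>_def
          using expander_connected_graph expander_random_starting_time by blast
      qed simp
      finally show ?case .
    qed
    show "(\<lambda>N. 2 - exp (1 / real N) - 1 / real N) \<longlonglongrightarrow> 1" by real_asymp
  qed auto
  ultimately show "\<exists>\<epsilon> :: nat \<Rightarrow> real. \<epsilon> \<longlonglongrightarrow> 0 \<and>
      (\<lambda>N. measure_pmf.prob (gnp N (p N))
        {E. connected_graph N E \<and>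
          (\<forall>i<N. \<bar>enn2ereal (random_starting_time N E i) / ereal (real N) - 1\<bar> \<le> ereal (\<epsilon> N))})
      \<longlonglongrightarrow> 1"
    by (intro exI[of _ \<epsilon>]) (simp add: G_def)
qed simp

end
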